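(* Fix $x\in[0,1]$, and let the model assumptions (A) described in the context hold. Then there exist finite, positive constants $c_1,c_2,c_3$ and $\nu>0$ (not depending on $N$, $h$, $v$) such that for all $N\in\mathbb N$, all $h>0$ and all $0\le v\le n^{\nu}$, where $n=n(h,x)=|\{k\in\{1,\dots,N\}: k/N\in[x-h,x+h]\}|$, $$\sup_{f}\ \mathbb P_f\Big(\big|\hat f_h(x)-f(x)\big|\ \ge\ c_1h^{\beta}+c_2\,n^{-1/\mathfrak a}\,v\Big)\ \le\ c_3\,e^{-v^{\mathfrak a}},$$ where the supremum is over all $f\in\mathcal H(L,\beta)$ with $0\le f\le\rho$, $\mathbb P_f$ is the probability under coefficient function $f$, and $\hat f_h(x)$ is the local polynomial quasi-maximum likelihood estimator defined in the context.
   Context: **Hölder class.** For $\beta>0$ put $\langle\beta\rangle=\max\{m\in\mathbb N_0: m<\beta\}$. $f\in\mathcal H(L,\beta)$ means that $f$ is $\langle\beta\rangle$ times differentiable and $|f^{(\langle\beta\rangle)}(y)-f^{(\langle\beta\rangle)}(z)|\le L|y-z|^{\beta-\langle\beta\rangle}$ for all $y,z$ in the domain of the function ($[0,1]$ for the coefficient function $f$; $[0,\infty)$ for $F_\varepsilon$ below). **Model assumptions (A).** Fix $L,\beta>0$, $\rho\in(0,1)$, $\mathfrak a,\mathfrak c,\mathfrak c_g,\delta\in(0,\infty)$, $L_\varepsilon,\beta_\varepsilon>0$. The coefficient function $f:[0,1]\to[0,\rho]$ lies in $\mathcal H(L,\beta)$ and is extended to $\mathbb R$ by $f(u)=f(0)$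 for $u<0$ and $f(u)=f(1)$ for $u>1$. The innovations $(\varepsilon_k)_{k\in\mathbb Z}$ are i.i.d. with distribution function $F_\varepsilon$ such that (i) as $y\downarrow0$, $F_\varepsilon(y)=\mathfrak c\,y^{\mathfrak a}+g(y)$ with $|g(y)|\le\mathfrak c_g\,y^{\mathfrak a+\delta}$ (so $\varepsilon_k\ge0$ a.s.), and $F_\varepsilon\in\mathcal H(L_\varepsilon,\beta_\varepsilon)$; (ii) $\mathbb E\varepsilon_1^p<\infty$ for $p=\max\{1,2\mathfrak a+\delta\}$. For $N\in\mathbb N$ the process satisfies $X_k=f(k/N)X_{k-1}+\varepsilon_k$ and is defined for all $k\in\mathbb Z$ by $X_k=\sum_{i\ge0}\big(\prod_{l=0}^{i-1}f(\tfrac{k-l}{N})\big)\varepsilon_{k-i}$. **Estimator.** Let $Y_k=X_k/X_{k-1}$. Consider polynomials $p(y)=\sum_{0\le i\le\beta+1}b_i(y-x)^i$ (sum over integers $i$). The coefficient vector $(\hat b_i)$ is a maximiser of $\sum_{k:|k/N-x|\le h}p(k/N)$ over all $(b_i)$, subject to the constraints $p(k/N)\le Y_k$ for all $k\in\{1,\dots,N\}$ with $|k/N-x|\le h$. Then $\hat f_h(x):=\hat b_0$. *)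

theory Defs
  imports "HOL-Probability.Probability"
begin

definition hoelder_order :: "real \<Rightarrow> nat" where
  "hoelder_order \<beta> = Max {m. real m < \<beta>}"

text \<open>
  The function \<open>D i\<close> is the \<open>i\<close>-th derivative on the domain \<open>S\<close>, one-sided at
  endpoints belonging to \<open>S\<close>.  Values of \<open>f\<close> outside \<open>S\<close> play no role.
\<close>
definition hoelder_class :: "real set \<Rightarrow> real \<Rightarrow> real \<Rightarrow> (real \<Rightarrow> real) set" where
  "hoelder_class S L \<beta> = {f. \<exists>D :: nat \<Rightarrow> real \<Rightarrow> real.
      D 0 = f \<and>
      (\<forall>i < hoelder_order \<beta>. \<forall>y\<in>S. (D i has_real_derivative D (Suc i) y) (at y within S)) \<and>
      (\<forall>y\<in>S. \<forall>z\<in>S. \<bar>D (hoelder_order \<beta>) y - D (hoelder_order \<beta>) z\<bar>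
         \<le> L * \<bar>y - z\<bar> powr (\<beta> - real (hoelder_order \<beta>)))}"

definition coeff_class :: "real \<Rightarrow> real \<Rightarrow> real \<Rightarrow> (real \<Rightarrow> real) set" where
  "coeff_class L \<beta> \<rho> = {f \<in> hoelder_class {0..1} L \<beta>. \<forall>u\<in>{0..1}. 0 \<le> f u \<and> f u \<le> \<rho>}"

definition const_ext :: "(real \<Rightarrow> real) \<Rightarrow> real \<Rightarrow> real" where
  "const_ext f u = (if u < 0 then f 0 else if u > 1 then f 1 else f u)"

definition tv_ar :: "(real \<Rightarrow> real) \<Rightarrow> (int \<Rightarrow> 'w \<Rightarrow> real) \<Rightarrow> nat \<Rightarrow> int \<Rightarrow> 'w \<Rightarrow> real" where
  "tv_ar f \<epsilon> N k \<omega> =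
     (\<Sum>i. (\<Prod>l<i. const_ext f (real_of_int (k - int l) / real N)) * \<epsilon> (k - int i) \<omega>)"

definition ar_ratio :: "(real \<Rightarrow> real) \<Rightarrow> (int \<Rightarrow> 'w \<Rightarrow> real) \<Rightarrow> nat \<Rightarrow> 'w \<Rightarrow> nat \<Rightarrow> real" where
  "ar_ratio f \<epsilon> N \<omega> k = tv_ar f \<epsilon> N (int k) \<omega> / tv_ar f \<epsilon> N (int k - 1) \<omega>"

definition window :: "nat \<Rightarrow> real \<Rightarrow> real \<Rightarrow> nat set" where
  "window N h x = {k \<in> {1..N}. \<bar>real k / real N - x\<bar> \<le> h}"

definition local_poly :: "real \<Rightarrow> real \<Rightarrow> (nat \<Rightarrow> real) \<Rightarrow> real \<Rightarrow> real" where
  "local_poly \<beta> x b y = (\<Sum>i | real i \<le> \<beta> + 1. b i * (y - x) ^ i)"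

definition qml_feasible ::
    "real \<Rightarrow> nat \<Rightarrow> real \<Rightarrow> real \<Rightarrow> (nat \<Rightarrow> real) \<Rightarrow> (nat \<Rightarrow> real) \<Rightarrow> bool" where
  "qml_feasible \<beta> N h x Y b \<longleftrightarrow>
     (\<forall>k\<in>window N h x. local_poly \<beta> x b (real k / real N) \<le> Y k)"

definition qml_objective :: "real \<Rightarrow> nat \<Rightarrow> real \<Rightarrow> real \<Rightarrow> (nat \<Rightarrow> real) \<Rightarrow> real" where
  "qml_objective \<beta> N h x b = (\<Sum>k\<in>window N h x. local_poly \<beta> x b (real k / real N))"

text \<open>
  The maximiser of the linear programme need not be unique, so being a value of the
  estimator for the data \<open>Y\<close> is a predicate: \<open>r\<close> is the constant coefficient of some
  maximiser.
\<close>
definition is_local_poly_qmle ::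
    "real \<Rightarrow> nat \<Rightarrow> real \<Rightarrow> real \<Rightarrow> (nat \<Rightarrow> real) \<Rightarrow> real \<Rightarrow> bool" where
  "is_local_poly_qmle \<beta> N h x Y r \<longleftrightarrow>
     (\<exists>b. qml_feasible \<beta> N h x Y b \<and>
          (\<forall>b'. qml_feasible \<beta> N h x Y b' \<longrightarrow> qml_objective \<beta> N h x b' \<le> qml_objective \<beta> N h x b) \<and>
          r = b 0)"

text \<open>
  \<open>fhat f\<close> is the estimator under the coefficient function \<open>f\<close>: a random variable whose
  value is almost surely the constant coefficient of a maximiser for the data generated
  by \<open>f\<close>.
\<close>
definition is_qml_estimator ::
    "'w measure \<Rightarrow> (int \<Rightarrow> 'w \<Rightarrow> real) \<Rightarrow> real \<Rightarrow> nat \<Rightarrow> real \<Rightarrow> real \<Rightarrow> (real \<Rightarrow> real) set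
       \<Rightarrow> ((real \<Rightarrow> real) \<Rightarrow> 'w \<Rightarrow> real) \<Rightarrow> bool" where
  "is_qml_estimator M \<epsilon> \<beta> N h x \<F> fhat \<longleftrightarrow>
     (\<forall>f\<in>\<F>. fhat f \<in> borel_measurable M \<and>
        (AE \<omega> in M. is_local_poly_qmle \<beta> N h x (ar_ratio f \<epsilon> N \<omega>) (fhat f \<omega>)))"

end

(*
  Since X_k >= eps_k, the noise in Y_k = f(k/N) + eps_k / X_{k-1} is at most t as soon as
  eps_{k-1} > y and eps_k <= t * y for a fixed small y, an event of probability of order t^a
  that involves neither f nor the remaining past.  Disjoint pairs (k-1, k) are independent, so
  outside an event of probability C exp(-c n t^a) every subinterval of the window whose length
  is a fixed proportion of it contains a point with noise at most t; t is taken proportional to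
  n^(-1/a) v.

  The Taylor polynomial of f at x, lowered by L h^beta, is feasible.  The difference of the
  maximiser and this polynomial therefore has nonnegative sum over the design and is bounded by
  t + 2 L h^beta at a point near each design point.  For polynomials of bounded degree this
  forces all coefficients, in the rescaled variable, to be of the order t + L h^beta.
*)
theory Submission
  imports Defs "HOL-Computational_Algebra.Polynomial"
begin


section \<open>One-sided control of polynomials on a grid\<close>

text \<open>Coefficients are controlled, rather than a sup norm over the window, because of the
  boundary: x may lie outside the range of the design points, so the value at x is an extrapolation.
  Both \<open>\<tau>\<close> and the number of blocks in the union bound depend only on \<beta>,
  which keeps the prefactor of the probability bound free of n. The scale n^(-1/\<aa>) comes from
  balancing: t is the value for which n t^\<aa> is a constant multiple of v^\<aa>. The restriction v
  \<le> n^\<nu> ensures t \<le> 1, so that the threshold t y stays where F is comparable with a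
  multiple of y^\<aa>; the choice \<nu> = 1/(2 \<aa>) leaves room for a large n to absorb the
  constant in t. Windows with few points are covered by enlarging the last constant, since there
  v^\<aa> \<le> sqrt n is bounded.\<close>

lemma abs_coeff_linear_mult_le:
  fixes q :: "real poly"
  assumes "\<bar>c\<bar> \<le> 1" "\<And>i. \<bar>coeff q i\<bar> \<le> B"
  shows "\<bar>coeff ([:-c, 1:] * q) i\<bar> \<le> 2 * B"
proof -
  have *: "\<bar>c * coeff q i\<bar> \<le> B" for i
    using mult_mono[OF assms(1) assms(2)[of i]] by (simp add: abs_mult)
  have "\<bar>coeff (pCons 0 q) i\<bar> \<le> B"
    using assms(2)[of "i - 1"] assms(2)[of 0] by (cases i) auto
  with *[of i] show ?thesis
    by (simp add: mult_pCons_left)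
qed

text \<open>Induction on the degree: dividing by the linear factor of the last node leaves a
  quotient of degree at most \<open>d\<close>, whose values at the other nodes are difference
  quotients of \<open>p\<close>, hence at most 2 B / \<gamma>. Multiplying back at most doubles the
  coefficient bound, as the nodes lie in [-1,1].\<close>

lemma coeff_bound_of_node_values:
  fixes u :: "nat \<Rightarrow> real"
  assumes "\<gamma> > 0" "\<And>i j. i < j \<Longrightarrow> j \<le> d \<Longrightarrow> \<gamma> \<le> \<bar>u i - u j\<bar>" "\<And>j. j \<le> d \<Longrightarrow> \<bar>u j\<bar> \<le> 1"
  shows "\<exists>K>0. \<forall>p B. degree p \<le> d \<longrightarrow> (\<forall>j\<le>d. \<bar>poly p (u j)\<bar> \<le> B) \<longrightarrow> (\<forall>i. \<bar>coeff p i\<bar> \<le> K * B)"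
  using assms(2,3)
proof (induction d)
  case 0
  have "\<bar>coeff p i\<bar> \<le> B" if "degree p = 0" "\<bar>poly p (u 0)\<bar> \<le> B" for p :: "real poly" and B i
    using that by (cases i) (auto elim!: degree_eq_zeroE simp: abs_le_iff)
  then show ?case
    by (intro exI[of _ 1]) auto
next
  case (Suc d)
  obtain K where K: "K > 0" and IH: "\<And>p B i. degree p \<le> d \<Longrightarrow> (\<And>j. j \<le> d \<Longrightarrow> \<bar>poly p (u j)\<bar> \<le> B) \<Longrightarrow> \<bar>coeff p i\<bar> \<le> K * B"
    using Suc.IH Suc.prems by (metis le_SucI)
  define c where "c = u (Suc d)"
  have "\<bar>coeff p i\<bar> \<le> (1 + 4 * K / \<gamma>) * B"
    if deg: "degree p \<le> Suc d" and B: "\<And>j. j \<le> Suc d \<Longrightarrow> \<bar>poly p (u j)\<bar> \<le> B" for p B i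
  proof -
    define q where "q = synthetic_div p c"
    have p: "p = [:-c, 1:] * q + [:poly p c:]"
      by (simp only: q_def synthetic_div_correct')
    have "\<bar>poly q (u j)\<bar> \<le> 2 * B / \<gamma>" if "j \<le> d" for j
    proof -
      have "poly p (u j) = poly ([:-c, 1:] * q + [:poly p c:]) (u j)"
        using p by simp
      then have "(u j - c) * poly q (u j) = poly p (u j) - poly p c"
        by (simp add: algebra_simps)
      then have "\<bar>u j - c\<bar> * \<bar>poly q (u j)\<bar> \<le> 2 * B"
        using B[of j] B[of "Suc d"] that unfolding c_def by (simp flip: abs_mult)
      moreover have "\<gamma> * \<bar>poly q (u j)\<bar> \<le> \<bar>u j - c\<bar> * \<bar>poly q (u j)\<bar>"
        using Suc.prems(1)[of j "Suc d"] that by (intro mult_right_mono) (auto simp: c_def)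
      ultimately show ?thesis
        using \<open>\<gamma> > 0\<close> by (simp add: field_simps)
    qed
    moreover have "degree q \<le> d"
      using deg by (simp add: q_def degree_synthetic_div)
    ultimately have "\<bar>coeff q i\<bar> \<le> K * (2 * B / \<gamma>)" for i
      using IH by blast
    then have "\<bar>coeff ([:-c, 1:] * q) i\<bar> \<le> 2 * (K * (2 * B / \<gamma>))"
      using Suc.prems(2)[of "Suc d"] by (intro abs_coeff_linear_mult_le) (auto simp: c_def)
    moreover have "\<bar>coeff [:poly p c:] i\<bar> \<le> B"
      using B[of "Suc d"] by (cases i) (auto simp: c_def)
    moreover have "coeff p i = coeff ([:-c, 1:] * q) i + coeff [:poly p c:] i"
      by (subst p) (simp only: coeff_add)
    ultimately show ?thesis
      by (simp add: algebra_simps)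
  qed
  moreover have "1 + 4 * K / \<gamma> > 0"
    using K \<open>\<gamma> > 0\<close> by (simp add: add_pos_pos)
  ultimately show ?case by blast
qed

lemma poly_lipschitz_of_coeff_bound:
  fixes p :: "real poly"
  assumes "degree p \<le> d" "\<And>i. \<bar>coeff p i\<bar> \<le> A" "\<bar>u\<bar> \<le> 1" "\<bar>w\<bar> \<le> 1"
  shows "\<bar>poly p u - poly p w\<bar> \<le> (real d + 1)\<^sup>2 * A * \<bar>u - w\<bar>"
proof -
  have A: "0 \<le> A" using assms(2)[of 0] by linarith
  have eval: "poly p y = (\<Sum>i\<le>d. coeff p i * y ^ i)" for y
    unfolding poly_altdef using assms(1)
    by (intro sum.mono_neutral_left) (auto simp: coeff_eq_0)
  have "\<bar>poly p u - poly p w\<bar> = \<bar>\<Sum>i\<le>d. coeff p i * (u ^ i - w ^ i)\<bar>"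
    by (simp add: eval right_diff_distrib sum_subtractf)
  also have "\<dots> \<le> (\<Sum>i\<le>d. \<bar>coeff p i * (u ^ i - w ^ i)\<bar>)"
    by (rule sum_abs)
  also have "\<dots> \<le> (\<Sum>i\<le>d. A * ((real d + 1) * \<bar>u - w\<bar>))"
  proof (rule sum_mono)
    fix i assume "i \<in> {..d}"
    have "\<bar>u ^ i - w ^ i\<bar> \<le> real i * \<bar>u - w\<bar>"
      using norm_power_diff[of u w i] assms(3,4) by simp
    also have "\<dots> \<le> (real d + 1) * \<bar>u - w\<bar>"
      using \<open>i \<in> {..d}\<close> by (intro mult_right_mono) auto
    finally show "\<bar>coeff p i * (u ^ i - w ^ i)\<bar> \<le> A * ((real d + 1) * \<bar>u - w\<bar>)"
      unfolding abs_mult using assms(2)[of i] A by (intro mult_mono) auto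
  qed
  finally show ?thesis
    by (simp add: power2_eq_square algebra_simps)
qed

lemma card_grid_interval_ge:
  fixes a b :: real
  assumes "0 \<le> a" "a \<le> b" "b \<le> 1" "n \<ge> 1"
  shows "real n * (b - a) - 1 \<le> real (card {k \<in> {1..n}. real k / real n \<in> {a..b}})"
proof -
  define l where "l = nat \<lfloor>real n * a\<rfloor>"
  define r where "r = nat \<lfloor>real n * b\<rfloor>"
  have l: "real l \<le> real n * a" "real n * a < real l + 1"
    using assms by (auto simp: l_def) 
  have r: "real r \<le> real n * b" "real n * b < real r + 1"
    using assms by (auto simp: r_def)
  \<comment> \<open>Starting at \<open>Suc l\<close> leaves out the index 0 when \<open>a\<close> is
    0, at the cost of at most one grid point.\<close>
  have "{Suc l..r} \<subseteq> {k \<in> {1..n}. real k / real n \<in> {a..b}}"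
  proof
    fix k assume "k \<in> {Suc l..r}"
    then have k: "real l + 1 \<le> real k" "real k \<le> real r" by auto
    moreover have "real n * b \<le> real n" using assms by (simp add: mult_left_le)
    ultimately have "real k \<le> real n" using r by linarith
    then show "k \<in> {k \<in> {1..n}. real k / real n \<in> {a..b}}"
      using k l r assms \<open>k \<in> {Suc l..r}\<close> by (auto simp: field_simps)
  qed
  then have "card {Suc l..r} \<le> card {k \<in> {1..n}. real k / real n \<in> {a..b}}"
    by (intro card_mono) auto
  moreover have "real r - real l \<le> real (card {Suc l..r})"
    by simp
  ultimately show ?thesis
    using l r by (simp add: algebra_simps)
qed

text \<open>
  With \<open>A\<close> the largest coefficient, the Lipschitz bound gives \<open>p \<le> t + \<Lambda> A \<tau>\<close> on the whole grid,
  so the sum condition bounds the mean of \<open>\<bar>p\<bar>\<close> by \<open>2 (t + \<Lambda> A \<tau>)\<close>.  That mean is also at least a fixed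
  multiple of \<open>A\<close>, because \<open>\<bar>p\<bar>\<close> is of order \<open>A\<close> near one of \<open>d + 1\<close> nodes, and for small \<open>\<tau>\<close> the term
  \<open>\<Lambda> A \<tau>\<close> is absorbed.
\<close>
lemma coeff_bound_of_one_sided_control:
  "\<exists>\<tau> K n\<^sub>0. \<tau> > 0 \<and> K > 0 \<and> (\<forall>n (p :: real poly) t.
      n \<ge> n\<^sub>0 \<longrightarrow> degree p \<le> d \<longrightarrow>
      (\<forall>i\<in>{1..n}. \<exists>k\<in>{1..n}. \<bar>real k - real i\<bar> \<le> \<tau> * real n \<and> poly p (real k / real n) \<le> t) \<longrightarrow>
      0 \<le> (\<Sum>k=1..n. poly p (real k / real n)) \<longrightarrow>
      (\<forall>i. \<bar>coeff p i\<bar> \<le> K * t))"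
proof -
  \<comment> \<open>The last node is d/(d+1) rather than 1, so an interval of length at most 1/(d+1)
    to the right of any node stays in [0,1].\<close>
  define u :: "nat \<Rightarrow> real" where "u j = real j / (real d + 1)" for j
  have gap: "1 / (real d + 1) \<le> \<bar>u i - u j\<bar>" if "i < j" for i j
    using that by (simp add: u_def field_simps flip: diff_divide_distrib)
  have u: "0 \<le> u j" "u j + 1 / (real d + 1) \<le> 1" if "j \<le> d" for j
    using that by (auto simp: u_def field_simps)
  have u1: "\<bar>u j\<bar> \<le> 1" if "j \<le> d" for j
    using that by (simp add: u_def)
  obtain K\<^sub>0 where "K\<^sub>0 > 0"
    and K\<^sub>0: "\<And>p B i. degree p \<le> d \<Longrightarrow> (\<And>j. j \<le> d \<Longrightarrow> \<bar>poly p (u j)\<bar> \<le> B) \<Longrightarrow> \<bar>coeff p i\<bar> \<le> K\<^sub>0 * B"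
    using coeff_bound_of_node_values[of "1 / (real d + 1)" d u] gap u1
    by (auto simp: add_pos_nonneg)
  define \<Lambda> where "\<Lambda> = (real d + 1)\<^sup>2"
  \<comment> \<open>Over a length \<open>\<sigma>\<close> the polynomial varies by at most A / (2
    \<open>K\<^sub>0\<close>), half of its guaranteed size at the best node; the second entry keeps
    the interval inside [0,1].\<close>
  define \<sigma> where "\<sigma> = min (1 / (2 * K\<^sub>0 * \<Lambda>)) (1 / (real d + 1))"
  \<comment> \<open>Makes \<Lambda> A \<tau> equal to \<sigma> A / (16 \<open>K\<^sub>0\<close>).
    Doubled, this is half of the lower bound \<sigma> A / (4 \<open>K\<^sub>0\<close>) for the mean
    of the absolute values; the other half is then at most 2 t.\<close>
  define \<tau> where "\<tau> = \<sigma> / (16 * K\<^sub>0 * \<Lambda>)"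
  have "\<Lambda> > 0" by (simp add: \<Lambda>_def add_nonneg_pos)
  have "\<sigma> > 0" using \<open>K\<^sub>0 > 0\<close> \<open>\<Lambda> > 0\<close> by (simp add: \<sigma>_def add_nonneg_pos)
  have "\<tau> > 0" using \<open>K\<^sub>0 > 0\<close> \<open>\<Lambda> > 0\<close> \<open>\<sigma> > 0\<close> by (simp add: \<tau>_def)
  have "\<bar>coeff p i\<bar> \<le> 16 * K\<^sub>0 / \<sigma> * t"
    if n: "real n \<ge> 2 / \<sigma>" and deg: "degree p \<le> d"
      and low: "\<forall>i\<in>{1..n}. \<exists>k\<in>{1..n}. \<bar>real k - real i\<bar> \<le> \<tau> * real n \<and> poly p (real k / real n) \<le> t"
      and sum: "0 \<le> (\<Sum>k=1..n. poly p (real k / real n))"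
    for n and p :: "real poly" and t i
  proof -
    have "real n > 0" using n \<open>\<sigma> > 0\<close> by (smt (verit) divide_pos_pos)
    define A where "A = Max ((\<lambda>i. \<bar>coeff p i\<bar>) ` {..d})"
    have A: "\<bar>coeff p i\<bar> \<le> A" for i
    proof (cases "i \<le> d")
      case False
      then have "coeff p i = 0" using deg by (simp add: coeff_eq_0)
      moreover have "\<bar>coeff p 0\<bar> \<le> A" unfolding A_def by (intro Max_ge) auto
      ultimately show ?thesis by simp
    qed (auto simp: A_def)
    have "A \<ge> 0" using A[of 0] by linarith
    have lip: "\<bar>poly p y - poly p z\<bar> \<le> \<Lambda> * A * \<bar>y - z\<bar>" if "\<bar>y\<bar> \<le> 1" "\<bar>z\<bar> \<le> 1" for y z
      unfolding \<Lambda>_def using poly_lipschitz_of_coeff_bound[OF deg A that] .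
    define B where "B = Max ((\<lambda>j. \<bar>poly p (u j)\<bar>) ` {..d})"
    have "B \<in> (\<lambda>j. \<bar>poly p (u j)\<bar>) ` {..d}" unfolding B_def by (intro Max_in) auto
    then obtain j where j: "j \<le> d" "B = \<bar>poly p (u j)\<bar>" by auto
    have "\<bar>poly p (u j)\<bar> \<le> B" if "j \<le> d" for j
      unfolding B_def using that by (intro Max_ge) auto
    from K\<^sub>0[OF deg this] have "A \<le> K\<^sub>0 * B" unfolding A_def by simp
    then have B: "A / K\<^sub>0 \<le> \<bar>poly p (u j)\<bar>" using j \<open>K\<^sub>0 > 0\<close> by (simp add: field_simps)
    define G where "G = {k \<in> {1..n}. real k / real n \<in> {u j..u j + \<sigma>}}"
    have \<sigma>1: "u j + \<sigma> \<le> 1" using u[OF j(1)] by (auto simp: \<sigma>_def)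
    have cardG: "real n * \<sigma> / 2 \<le> real (card G)"
    proof -
      have "real n * (u j + \<sigma> - u j) - 1 \<le> real (card G)"
        unfolding G_def using u[OF j(1)] \<sigma>1 \<open>\<sigma> > 0\<close> \<open>real n > 0\<close> by (intro card_grid_interval_ge) auto
      \<comment> \<open>The grid point lost in the count is at most half of n \<sigma>; this is the
        purpose of the lower bound on \<open>n\<close>.\<close>
      moreover have "1 \<le> real n * \<sigma> / 2" using n \<open>\<sigma> > 0\<close> by (simp add: field_simps)
      ultimately show ?thesis by simp
    qed
    have near: "A / (2 * K\<^sub>0) \<le> \<bar>poly p (real k / real n)\<bar>" if "k \<in> G" for k
    proof -
      have "\<bar>u j - real k / real n\<bar> \<le> 1 / (2 * K\<^sub>0 * \<Lambda>)"
        using that by (auto simp: G_def \<sigma>_def)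
      then have "\<Lambda> * A * \<bar>u j - real k / real n\<bar> \<le> \<Lambda> * A * (1 / (2 * K\<^sub>0 * \<Lambda>))"
        using \<open>\<Lambda> > 0\<close> \<open>A \<ge> 0\<close> by (intro mult_left_mono) auto
      also have "\<dots> = A / (2 * K\<^sub>0)" using \<open>\<Lambda> > 0\<close> by simp
      finally have "\<bar>poly p (u j) - poly p (real k / real n)\<bar> \<le> A / (2 * K\<^sub>0)"
        using lip[of "u j" "real k / real n"] u1[OF j(1)] that \<open>real n > 0\<close> by (auto simp: G_def)
      moreover have "A / K\<^sub>0 = 2 * (A / (2 * K\<^sub>0))" by simp
      ultimately show ?thesis using B by linarith
    qed
    have upper: "poly p (real i / real n) \<le> t + \<Lambda> * A * \<tau>" if i: "i \<in> {1..n}" for i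
    proof -
      obtain k where k: "k \<in> {1..n}" "\<bar>real k - real i\<bar> \<le> \<tau> * real n" "poly p (real k / real n) \<le> t"
        using low i by blast
      have "\<bar>real i / real n - real k / real n\<bar> \<le> \<tau>"
        using k(2) \<open>real n > 0\<close> by (simp add: field_simps flip: diff_divide_distrib)
      then have "\<Lambda> * A * \<bar>real i / real n - real k / real n\<bar> \<le> \<Lambda> * A * \<tau>"
        using \<open>\<Lambda> > 0\<close> \<open>A \<ge> 0\<close> by (intro mult_left_mono) auto
      moreover have "\<bar>poly p (real i / real n) - poly p (real k / real n)\<bar> \<le> \<Lambda> * A * \<bar>real i / real n - real k / real n\<bar>"
        using i k by (intro lip) auto
      ultimately show ?thesis using k(3) by linarith
    qed
    define T where "T = t + \<Lambda> * A * \<tau>"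
    \<comment> \<open>The sign of \<open>t\<close> is not given, but a negative \<open>T\<close>
      would make every summand negative.\<close>
    have "T \<ge> 0"
    proof (rule ccontr)
      assume "\<not> T \<ge> 0"
      then have "(\<Sum>k=1..n. poly p (real k / real n)) \<le> (\<Sum>k=1..n. T)"
        using upper by (intro sum_mono) (auto simp: T_def)
      also have "\<dots> < 0" using \<open>\<not> T \<ge> 0\<close> \<open>real n > 0\<close> by (simp add: mult_pos_neg)
      finally show False using sum by simp
    qed
    have "real n * \<sigma> / 2 * (A / (2 * K\<^sub>0)) \<le> real (card G) * (A / (2 * K\<^sub>0))"
      using cardG \<open>A \<ge> 0\<close> \<open>K\<^sub>0 > 0\<close> by (intro mult_right_mono) auto
    also have "\<dots> = (\<Sum>k\<in>G. A / (2 * K\<^sub>0))" by simp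
    also have "\<dots> \<le> (\<Sum>k\<in>G. \<bar>poly p (real k / real n)\<bar>)" by (intro sum_mono near)
    also have "\<dots> \<le> (\<Sum>k=1..n. \<bar>poly p (real k / real n)\<bar>)"
      by (intro sum_mono2) (auto simp: G_def)
    \<comment> \<open>For p \<ge> 0 the bound |p| \<le> 2 T - p says p \<le> T, and for p < 0 it
      says T \<ge> 0. With the sum condition it turns the one-sided bound into a bound on the mean
      of |p|.\<close>
    also have "\<dots> \<le> (\<Sum>k=1..n. 2 * T - poly p (real k / real n))"
      using upper \<open>T \<ge> 0\<close> unfolding T_def[symmetric] by (intro sum_mono) (fastforce simp: abs_if)
    also have "\<dots> \<le> 2 * T * real n" using sum by (simp add: sum_subtractf)
    finally have "real n * (\<sigma> * A / (4 * K\<^sub>0)) \<le> real n * (2 * T)" by (simp add: algebra_simps)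
    then have "\<sigma> * A / (4 * K\<^sub>0) \<le> 2 * T"
      using \<open>real n > 0\<close> by (rule mult_left_le_imp_le)
    moreover have "\<Lambda> * A * \<tau> = \<sigma> * A / (16 * K\<^sub>0)" using \<open>\<Lambda> > 0\<close> by (simp add: \<tau>_def)
    ultimately have "\<sigma> * A / (16 * K\<^sub>0) \<le> t"
      unfolding T_def by (simp add: field_simps)
    then have "A \<le> 16 * K\<^sub>0 / \<sigma> * t" using \<open>\<sigma> > 0\<close> \<open>K\<^sub>0 > 0\<close> by (simp add: field_simps)
    then show ?thesis using A[of i] by linarith
  qed
  moreover have "real n \<ge> 2 / \<sigma>" if "n \<ge> nat \<lceil>2 / \<sigma>\<rceil>" for n
    using that by linarith
  ultimately show ?thesis
    using \<open>\<tau> > 0\<close> \<open>K\<^sub>0 > 0\<close> \<open>\<sigma> > 0\<close>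
    by (intro exI[of _ \<tau>] exI[of _ "16 * K\<^sub>0 / \<sigma>"] exI[of _ "nat \<lceil>2 / \<sigma>\<rceil>"]) auto
qed

section \<open>Taylor approximation\<close>

lemma hoelder_order_less:
  assumes "\<beta> > 0"
  shows "real (hoelder_order \<beta>) < \<beta>"
proof -
  have "{m. real m < \<beta>} \<subseteq> {..nat \<lceil>\<beta>\<rceil>}" by (auto; linarith)
  then have "finite {m. real m < \<beta>}" by (rule finite_subset) simp
  then have "hoelder_order \<beta> \<in> {m. real m < \<beta>}"
    unfolding hoelder_order_def using assms by (intro Max_in) (auto intro: exI[of _ 0])
  then show ?thesis by simp
qed

text \<open>Descent from the top derivative: the remainder of \<open>D i\<close> vanishes at
  \<open>x\<close> and its derivative is the remainder of \<open>D (Suc i)\<close>, so the mean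
  value inequality on the segment gains one factor |y - x|. Using the bound at the far end
  throughout gains no factorial but preserves the constant \<open>L\<close>.\<close>

lemma taylor_remainder_powr_bound:
  fixes D :: "nat \<Rightarrow> real \<Rightarrow> real" and S :: "real set"
  assumes S: "convex S" and x: "x \<in> S" and L: "L \<ge> 0" and m: "real m < \<beta>"
    and deriv: "\<And>i y. i < m \<Longrightarrow> y \<in> S \<Longrightarrow> (D i has_real_derivative D (Suc i) y) (at y within S)"
    and top: "\<And>y. y \<in> S \<Longrightarrow> \<bar>D m y - D m x\<bar> \<le> L * \<bar>y - x\<bar> powr (\<beta> - real m)"
    and "y \<in> S"
  shows "\<bar>D 0 y - (\<Sum>j\<le>m. D j x / fact j * (y - x) ^ j)\<bar> \<le> L * \<bar>y - x\<bar> powr \<beta>"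
proof -
  have "\<forall>y\<in>S. \<bar>D (m - l) y - (\<Sum>j\<le>l. D (m - l + j) x / fact j * (y - x) ^ j)\<bar> \<le> L * \<bar>y - x\<bar> powr (\<beta> - real (m - l))"
    if "l \<le> m" for l
    using that
  proof (induction l)
    case 0
    then show ?case using top by simp
  next
    case (Suc l)
    define i where "i = m - Suc l"
    have i: "m - l = Suc i" "i < m" using Suc.prems by (auto simp: i_def)
    define R where "R y = D i y - (\<Sum>j\<le>Suc l. D (i + j) x / fact j * (y - x) ^ j)" for y
    define R' where "R' y = D (Suc i) y - (\<Sum>j\<le>l. D (Suc i + j) x / fact j * (y - x) ^ j)" for y
    have IH: "\<bar>R' y\<bar> \<le> L * \<bar>y - x\<bar> powr (\<beta> - real (Suc i))" if "y \<in> S" for y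
      using Suc.IH Suc.prems that unfolding R'_def i by simp
    have R: "R y = D i y - D i x - (\<Sum>j\<le>l. D (Suc i + j) x / fact (Suc j) * (y - x) ^ Suc j)" for y
      unfolding R_def by (subst sum.atMost_Suc_shift) simp
    have fact_cancel: "a / (fact j + real j * fact j) * (b * real (Suc j)) = a / fact j * b" for a b j
    proof -
      have "fact j + real j * fact j = real (Suc j) * fact j" by (simp add: algebra_simps)
      then show ?thesis by simp
    qed
    have dR: "(R has_real_derivative R' z) (at z within T)" if "z \<in> T" "T \<subseteq> S" for z T
      unfolding R R'_def
      by (rule derivative_eq_intros DERIV_subset[OF deriv] refl i that subsetD[OF that(2,1)])+
         (simp add: fact_cancel mult.commute del: of_nat_Suc power_Suc)
    have "\<bar>R y\<bar> \<le> L * \<bar>y - x\<bar> powr (\<beta> - real i)" if y: "y \<in> S" for y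
    proof -
      have seg: "closed_segment x y \<subseteq> S" using S x y by (simp add: closed_segment_subset)
      have "\<bar>R' z\<bar> \<le> L * \<bar>y - x\<bar> powr (\<beta> - real (Suc i))" if "z \<in> closed_segment x y" for z
      proof -
        have "\<bar>R' z\<bar> \<le> L * \<bar>z - x\<bar> powr (\<beta> - real (Suc i))" using IH seg that by blast
        \<comment> \<open>Monotonicity needs a nonnegative exponent, which holds because Suc i \<le>
          m < \<beta>.\<close>
        also have "\<dots> \<le> L * \<bar>y - x\<bar> powr (\<beta> - real (Suc i))"
          using that i m L
          by (intro mult_left_mono powr_mono2) (auto simp: closed_segment_eq_real_ivl split: if_splits)
        finally show ?thesis .
      qed
      then have "norm (R y - R x) \<le> L * \<bar>y - x\<bar> powr (\<beta> - real (Suc i)) * norm (y - x)"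
        using seg by (intro field_differentiable_bound[of "closed_segment x y" R R'] dR) auto
      moreover have "R x = 0" unfolding R by simp
      moreover have "\<bar>y - x\<bar> powr (\<beta> - real (Suc i)) * \<bar>y - x\<bar> = \<bar>y - x\<bar> powr (\<beta> - real i)"
        by (cases "y = x") (simp_all add: powr_mult_base mult.commute algebra_simps)
      ultimately show ?thesis by (simp add: mult.assoc)
    qed
    then show ?case unfolding R_def i_def by blast
  qed
  from this[of m] \<open>y \<in> S\<close> show ?thesis by simp
qed


section \<open>Runs without a small noise ratio\<close>

text \<open>Relative to the leading power the remainder is O(y^\<delta>), so eventually it takes
  away at most half of the leading coefficient.\<close>

lemma power_law_bounds_at_right:
  fixes F g :: "real \<Rightarrow> real"
  assumes "c > 0" "C \<ge> 0" "\<delta> > 0"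
    and "\<forall>\<^sub>F y in at_right 0. F y = c * y powr a + g y \<and> \<bar>g y\<bar> \<le> C * y powr (a + \<delta>)"
  shows "\<forall>\<^sub>F y in at_right 0. c / 2 * y powr a \<le> F y \<and> F y \<le> 2 * c * y powr a"
proof -
  have "((\<lambda>y. C * y powr \<delta>) \<longlongrightarrow> C * 0 powr \<delta>) (at_right 0)"
    using \<open>\<delta> > 0\<close> by (intro tendsto_intros tendsto_powr2) (auto simp: eventually_at_right_less intro: eventually_mono[OF eventually_at_right_less])
  then have "\<forall>\<^sub>F y in at_right 0. C * y powr \<delta> < c / 2"
    using \<open>c > 0\<close> by (intro order_tendstoD) auto
  with assms(4) show ?thesis
  proof eventually_elim
    case (elim y)
    have "C * y powr (a + \<delta>) = (C * y powr \<delta>) * y powr a" by (simp add: powr_add)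
    also have "\<dots> \<le> c / 2 * y powr a" using elim by (intro mult_right_mono) auto
    finally have "\<bar>g y\<bar> \<le> c / 2 * y powr a" using elim by linarith
    moreover have "c * y powr a \<ge> 0" using \<open>c > 0\<close> by simp
    ultimately show ?case using elim by (auto simp: abs_le_iff)
  qed
qed

context prob_space
begin

text \<open>Overlapping pairs (k-1, k) are dependent, so only the disjoint pairs (s+2l, s+2l+1) are
  kept, which halves the number of trials. Each pair is treated as one random vector, and these
  vectors are independent.\<close>

lemma prob_no_consecutive_hit_le:
  fixes \<epsilon> :: "int \<Rightarrow> 'a \<Rightarrow> real"
  assumes indep: "indep_vars (\<lambda>_. borel) \<epsilon> UNIV"
    and A: "A \<in> sets borel" and B: "B \<in> sets borel"
    and a: "\<And>k. a = prob (\<epsilon> k -` A \<inter> space M)" and b: "\<And>k. b = prob (\<epsilon> k -` B \<inter> space M)"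
  shows "prob {\<omega> \<in> space M. \<forall>k\<in>{s + 1..s + int m}. \<not> (\<epsilon> (k - 1) \<omega> \<in> A \<and> \<epsilon> k \<omega> \<in> B)} \<le> (1 - a * b) ^ (m div 2)"
    (is "prob ?E \<le> _")
\<comment> \<open>Without a complete pair the bound is 1; the product rule for independent families
  asks for a nonempty index set.\<close>
proof (cases "m div 2 = 0")
  case True
  then show ?thesis by simp
next
  case False
  have [measurable]: "\<epsilon> k \<in> borel_measurable M" for k
    using indep by (auto simp: indep_vars_def)
  note [measurable] = A B
  define K where "K l = {s + 2 * int l, s + 2 * int l + 1}" for l :: nat
  define Z where "Z l = (\<lambda>\<omega>. restrict (\<lambda>i. \<epsilon> i \<omega>) (K l))" for l
  define W where "W l = {w \<in> space (PiM (K l) (\<lambda>_. borel)). \<not> (w (s + 2 * int l) \<in> A \<and> w (s + 2 * int l + 1) \<in> B)}" for l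
  have W: "W l \<in> sets (PiM (K l) (\<lambda>_. borel))" for l
  proof -
    have [measurable]: "s + 2 * int l \<in> K l" "s + 2 * int l + 1 \<in> K l" by (auto simp: K_def)
    show ?thesis unfolding W_def by measurable
  qed
  have "disjoint_family_on K {..<m div 2}"
    unfolding disjoint_family_on_def K_def by auto
  then have "indep_vars (\<lambda>l. PiM (K l) (\<lambda>_. borel)) Z {..<m div 2}"
    unfolding Z_def by (intro indep_vars_restrict[OF indep]) auto
  then have prod: "prob (\<Inter>l<m div 2. Z l -` W l \<inter> space M) = (\<Prod>l<m div 2. prob (Z l -` W l \<inter> space M))"
    using False W by (intro indep_varsD) auto
  have "prob (Z l -` W l \<inter> space M) = 1 - a * b" for l
  proof -
    define k where "k = s + 2 * int l + 1"
    have km: "s + 2 * int l = k - 1" by (simp add: k_def)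
    have "prob (\<Inter>i\<in>{k - 1, k}. \<epsilon> i -` (if i = k then B else A) \<inter> space M)
        = (\<Prod>i\<in>{k - 1, k}. prob (\<epsilon> i -` (if i = k then B else A) \<inter> space M))"
      by (intro indep_varsD[OF indep]) auto
    also have "\<dots> = a * b" using a[of "k - 1"] b[of k] by simp
    also have "(\<Inter>i\<in>{k - 1, k}. \<epsilon> i -` (if i = k then B else A) \<inter> space M)
        = {\<omega> \<in> space M. \<epsilon> (k - 1) \<omega> \<in> A \<and> \<epsilon> k \<omega> \<in> B}" by auto
    finally have "prob {\<omega> \<in> space M. \<not> (\<epsilon> (k - 1) \<omega> \<in> A \<and> \<epsilon> k \<omega> \<in> B)} = 1 - a * b"
      by (subst prob_neg) auto
    also have "{\<omega> \<in> space M. \<not> (\<epsilon> (k - 1) \<omega> \<in> A \<and> \<epsilon> k \<omega> \<in> B)} = Z l -` W l \<inter> space M"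
      unfolding Z_def W_def km k_def[symmetric] by (auto simp: K_def space_PiM km k_def[symmetric])
    finally show ?thesis .
  qed
  with prod have "prob (\<Inter>l<m div 2. Z l -` W l \<inter> space M) = (1 - a * b) ^ (m div 2)" by simp
  moreover have "prob ?E \<le> prob (\<Inter>l<m div 2. Z l -` W l \<inter> space M)"
  proof (intro finite_measure_mono)
    show "?E \<subseteq> (\<Inter>l<m div 2. Z l -` W l \<inter> space M)"
    proof (intro INT_greatest subsetI)
      fix l \<omega> assume l: "l \<in> {..<m div 2}" and \<omega>: "\<omega> \<in> ?E"
      have "s + 2 * int l + 1 \<in> {s + 1..s + int m}" using l by auto
      then have "\<not> (\<epsilon> (s + 2 * int l + 1 - 1) \<omega> \<in> A \<and> \<epsilon> (s + 2 * int l + 1) \<omega> \<in> B)"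
        using \<omega> by blast
      then show "\<omega> \<in> Z l -` W l \<inter> space M"
        using \<omega> by (auto simp: Z_def W_def K_def space_PiM)
    qed
    show "(\<Inter>l<m div 2. Z l -` W l \<inter> space M) \<in> events"
    proof -
      have "Z l \<in> measurable M (PiM (K l) (\<lambda>_. borel))" for l
        unfolding Z_def by measurable
      then have "Z l -` W l \<inter> space M \<in> events" for l
        using W by (rule measurable_sets)
      then show ?thesis using False by (intro sets.finite_INT) auto
    qed
  qed
  ultimately show ?thesis by simp
qed

lemma cdf_distr_eq:
  assumes "random_variable borel Y"
  shows "cdf (distr M borel Y) y = prob {\<omega> \<in> space M. Y \<omega> \<le> y}"
  unfolding cdf_def using assms
  by (subst measure_distr) (auto simp: vimage_def intro!: arg_cong[where f=prob])

text \<open>The level \<open>y\<^sub>1\<close> is exceeded with probability at least 1/2, and t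
  \<le> 1 keeps t \<open>y\<^sub>1\<close> in the range of the power law. So a pair succeeds with
  probability q of order at least t^a, and 1 - q \<le> exp (- q).\<close>

lemma prob_no_small_ratio_le:
  fixes \<epsilon> :: "int \<Rightarrow> 'a \<Rightarrow> real"
  assumes indep: "indep_vars (\<lambda>_. borel) \<epsilon> UNIV"
    and cdf: "\<And>k. cdf (distr M borel (\<epsilon> k)) = F"
    and "a > 0" "c > 0"
    and near: "\<forall>\<^sub>F y in at_right 0. c / 2 * y powr a \<le> F y \<and> F y \<le> 2 * c * y powr a"
  shows "\<exists>y\<^sub>1 \<kappa>. y\<^sub>1 > 0 \<and> \<kappa> > 0 \<and> (\<forall>t s m. 0 < t \<longrightarrow> t \<le> 1 \<longrightarrow>
     prob {\<omega> \<in> space M. \<forall>k\<in>{s + 1..s + int m}. \<not> (y\<^sub>1 < \<epsilon> (k - 1) \<omega> \<and> \<epsilon> k \<omega> \<le> t * y\<^sub>1)}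
       \<le> exp (- \<kappa> * t powr a * real (m div 2)))"
proof -
  have [measurable]: "\<epsilon> k \<in> borel_measurable M" for k
    using indep by (auto simp: indep_vars_def)
  have F: "F y = prob {\<omega> \<in> space M. \<epsilon> k \<omega> \<le> y}" for y k
    using cdf_distr_eq[of "\<epsilon> k" y] cdf[of k] by simp
  have "((\<lambda>y. 2 * c * y powr a) \<longlongrightarrow> 2 * c * 0 powr a) (at_right 0)"
    using \<open>a > 0\<close> by (intro tendsto_intros tendsto_powr2) (auto intro: eventually_mono[OF eventually_at_right_less])
  then have "\<forall>\<^sub>F y in at_right 0. 2 * c * y powr a < 1 / 2"
    by (rule order_tendstoD) auto
  with near have "\<forall>\<^sub>F y in at_right 0. c / 2 * y powr a \<le> F y \<and> F y \<le> 1 / 2"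
    by eventually_elim auto
  then obtain y\<^sub>0 where y0: "y\<^sub>0 > 0" "\<And>y. 0 < y \<Longrightarrow> y < y\<^sub>0 \<Longrightarrow> c / 2 * y powr a \<le> F y \<and> F y \<le> 1 / 2"
    by (auto simp: eventually_at_right_field)
  define y\<^sub>1 where "y\<^sub>1 = y\<^sub>0 / 2"
  \<comment> \<open>A factor 1/2 from the first member of a pair times c/2 (t
    \<open>y\<^sub>1\<close>)^a from the second, with t^a taken out.\<close>
  define \<kappa> where "\<kappa> = c / 4 * y\<^sub>1 powr a"
  have pos: "y\<^sub>1 > 0" "\<kappa> > 0" "y\<^sub>1 < y\<^sub>0"
    using y0(1) \<open>c > 0\<close> by (auto simp: y\<^sub>1_def \<kappa>_def)
  have "prob {\<omega> \<in> space M. \<forall>k\<in>{s + 1..s + int m}. \<not> (y\<^sub>1 < \<epsilon> (k - 1) \<omega> \<and> \<epsilon> k \<omega> \<le> t * y\<^sub>1)}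
       \<le> exp (- \<kappa> * t powr a * real (m div 2))" if t: "0 < t" "t \<le> 1" for t s m
  proof -
    define q where "q = (1 - F y\<^sub>1) * F (t * y\<^sub>1)"
    have 1: "1 - F y\<^sub>1 = prob (\<epsilon> k -` {y\<^sub>1<..} \<inter> space M)" for k
    proof -
      have "prob {\<omega> \<in> space M. \<not> \<epsilon> k \<omega> \<le> y\<^sub>1} = 1 - F y\<^sub>1"
        unfolding F[of _ k] by (subst prob_neg) auto
      moreover have "{\<omega> \<in> space M. \<not> \<epsilon> k \<omega> \<le> y\<^sub>1} = \<epsilon> k -` {y\<^sub>1<..} \<inter> space M" by auto
      ultimately show ?thesis by simp
    qed
    have 2: "F (t * y\<^sub>1) = prob (\<epsilon> k -` {..t * y\<^sub>1} \<inter> space M)" for k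
      unfolding F[of _ k] by (auto intro!: arg_cong[where f=prob])
    have "q \<le> 1"
      unfolding q_def 1[of 0] 2[of 0] by (intro mult_le_one) auto
    have "t * y\<^sub>1 < y\<^sub>0" using t pos by (smt (verit) mult_left_le_one_le)
    then have "1 / 2 * (c / 2 * (t * y\<^sub>1) powr a) \<le> q"
      unfolding q_def using y0(2)[of y\<^sub>1] y0(2)[of "t * y\<^sub>1"] t pos \<open>c > 0\<close>
      by (intro mult_mono) auto
    then have q: "\<kappa> * t powr a \<le> q"
      using t pos by (simp add: \<kappa>_def powr_mult algebra_simps)
    have "prob {\<omega> \<in> space M. \<forall>k\<in>{s + 1..s + int m}. \<not> (y\<^sub>1 < \<epsilon> (k - 1) \<omega> \<and> \<epsilon> k \<omega> \<le> t * y\<^sub>1)} \<le> (1 - q) ^ (m div 2)"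
      using prob_no_consecutive_hit_le[OF indep _ _ 1 2, of s m] by (simp add: q_def)
    also have "\<dots> \<le> exp (- (\<kappa> * t powr a)) ^ (m div 2)"
      using \<open>q \<le> 1\<close> q exp_ge_add_one_self[of "- (\<kappa> * t powr a)"] by (intro power_mono) linarith+
    also have "\<dots> = exp (- \<kappa> * t powr a * real (m div 2))"
      by (simp add: mult.commute flip: exp_of_nat_mult)
    finally show ?thesis .
  qed
  with pos show ?thesis by blast
qed

text \<open>A union over all centres \<open>i\<close> would cost a factor n. Cutting the range into
  a fixed number of equal blocks, so short that every neighbourhood contains a whole block, costs
  only the number of blocks.\<close>

lemma prob_small_ratio_gap_le:
  fixes \<epsilon> :: "int \<Rightarrow> 'a \<Rightarrow> real"
  assumes indep: "indep_vars (\<lambda>_. borel) \<epsilon> UNIV"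
    and cdf: "\<And>k. cdf (distr M borel (\<epsilon> k)) = F"
    and "a > 0" "c > 0"
    and near: "\<forall>\<^sub>F y in at_right 0. c / 2 * y powr a \<le> F y \<and> F y \<le> 2 * c * y powr a"
    and "\<tau> > 0"
  shows "\<exists>y\<^sub>1 \<kappa> C n\<^sub>0. y\<^sub>1 > 0 \<and> \<kappa> > 0 \<and> C > 0 \<and> (\<forall>t s n. 0 < t \<longrightarrow> t \<le> 1 \<longrightarrow> n \<ge> n\<^sub>0 \<longrightarrow>
     prob {\<omega> \<in> space M. \<exists>i\<in>{1..n}. \<forall>k\<in>{1..n}. \<bar>real k - real i\<bar> \<le> \<tau> * real n \<longrightarrow>
         \<not> (y\<^sub>1 < \<epsilon> (s + int k - 1) \<omega> \<and> \<epsilon> (s + int k) \<omega> \<le> t * y\<^sub>1)}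
       \<le> C * exp (- \<kappa> * t powr a * real n))"
proof -
  have [measurable]: "\<epsilon> k \<in> borel_measurable M" for k
    using indep by (auto simp: indep_vars_def)
  obtain y\<^sub>1 \<kappa> where pos: "y\<^sub>1 > 0" "\<kappa> > 0"
    and block: "\<And>t s m. 0 < t \<Longrightarrow> t \<le> 1 \<Longrightarrow>
     prob {\<omega> \<in> space M. \<forall>k\<in>{s + 1..s + int m}. \<not> (y\<^sub>1 < \<epsilon> (k - 1) \<omega> \<and> \<epsilon> k \<omega> \<le> t * y\<^sub>1)}
       \<le> exp (- \<kappa> * t powr a * real (m div 2))"
    using prob_no_small_ratio_le[OF indep cdf \<open>a > 0\<close> \<open>c > 0\<close> near] by blast
  \<comment> \<open>A block has length about n / J \<le> \<tau> n / 2, so a block starting or ending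
    within one block length of \<open>i\<close> stays within distance \<tau> n.\<close>
  define J where "J = Suc (nat \<lceil>2 / \<tau>\<rceil>)"
  have "2 / \<tau> \<le> real J" unfolding J_def by linarith
  then have J: "2 \<le> \<tau> * real J" "J > 0" using \<open>\<tau> > 0\<close> by (auto simp: field_simps J_def)
  have "prob {\<omega> \<in> space M. \<exists>i\<in>{1..n}. \<forall>k\<in>{1..n}. \<bar>real k - real i\<bar> \<le> \<tau> * real n \<longrightarrow>
         \<not> (y\<^sub>1 < \<epsilon> (s + int k - 1) \<omega> \<and> \<epsilon> (s + int k) \<omega> \<le> t * y\<^sub>1)}
       \<le> real J * exp (- (\<kappa> / (8 * real J)) * t powr a * real n)" (is "prob ?E \<le> _")
    if t: "0 < t" "t \<le> 1" and n: "n \<ge> J * J + 2 * J" for t s n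
  proof -
    define m where "m = n div J"
    have nJ: "J * m \<le> n" "n < J * m + J"
      using J dividend_less_times_div[of J n] by (simp_all add: m_def)
    \<comment> \<open>The tail left over by the J blocks has fewer than J indices, hence is shorter
      than one block.\<close>
    have "J + 2 \<le> m"
    proof -
      have "(J + 2) * J div J \<le> n div J" using n by (intro div_le_mono) (simp add: algebra_simps)
      then show ?thesis using J by (simp add: m_def)
    qed
    have m\<tau>: "2 * real m \<le> \<tau> * real n"
    proof -
      have "2 * real m \<le> (\<tau> * real J) * real m" using J by (intro mult_right_mono) auto
      also have "\<dots> = \<tau> * real (J * m)" by simp
      also have "\<dots> \<le> \<tau> * real n" using nJ(1) \<open>\<tau> > 0\<close> by (intro mult_left_mono) (simp_all only: of_nat_le_iff)
      finally show ?thesis .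
    qed
    define Bad where "Bad j = {\<omega> \<in> space M. \<forall>k\<in>{(s + int (j * m)) + 1..(s + int (j * m)) + int m}. \<not> (y\<^sub>1 < \<epsilon> (k - 1) \<omega> \<and> \<epsilon> k \<omega> \<le> t * y\<^sub>1)}" for j
    have Bad_sets: "Bad j \<in> events" for j unfolding Bad_def by measurable
    have "?E \<subseteq> (\<Union>j<J. Bad j)"
    proof
      fix \<omega> assume \<omega>: "\<omega> \<in> ?E"
      then obtain i where i: "i \<in> {1..n}" and
        bad: "\<And>k. k \<in> {1..n} \<Longrightarrow> \<bar>real k - real i\<bar> \<le> \<tau> * real n \<Longrightarrow>
         \<not> (y\<^sub>1 < \<epsilon> (s + int k - 1) \<omega> \<and> \<epsilon> (s + int k) \<omega> \<le> t * y\<^sub>1)" by blast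
      obtain j where j: "j < J" and close: "\<And>k. k \<in> {j * m + 1..j * m + m} \<Longrightarrow> k \<le> i + 2 * m \<and> i \<le> k + 2 * m"
      proof (cases "(i - 1) div m < J")
        case True
        define q where "q = (i - 1) div m"
        have "q * m \<le> i - 1" "i - 1 < q * m + m" "q < J"
          using \<open>J + 2 \<le> m\<close> dividend_less_div_times[of m "i - 1"] True by (simp_all add: q_def)
        with i show ?thesis by (intro that[of q]) auto
      next
        \<comment> \<open>Here \<open>i\<close> lies in the tail behind the last complete block, and
          that last block is near enough.\<close>
        case False
        have "J * m \<le> (i - 1) div m * m" using False by (intro mult_right_mono) auto
        also have "\<dots> \<le> i - 1" by simp
        finally have "J * m \<le> i - 1" .
        moreover have "(J - 1) * m + m = J * m" using J by (cases J) auto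
        ultimately show ?thesis
          using i nJ \<open>J + 2 \<le> m\<close> J(2)
          by (intro that[of "J - 1"]) auto
      qed
      have jm: "j * m + m \<le> n"
      proof -
        have "Suc j * m \<le> J * m" using j by (intro mult_right_mono) auto
        then show ?thesis using nJ(1) by simp
      qed
      have "\<omega> \<in> Bad j"
        unfolding Bad_def
      proof (intro CollectI conjI ballI)
        show "\<omega> \<in> space M" using \<omega> by simp
        fix k assume k: "k \<in> {s + int (j * m) + 1..s + int (j * m) + int m}"
        define k' where "k' = nat (k - s)"
        have "k - s \<ge> 0" using k by (simp del: of_nat_mult)
        then have ks: "k = s + int k'" by (simp add: k'_def)
        moreover have "k' \<in> {j * m + 1..j * m + m}" using k unfolding ks by (simp del: of_nat_mult)
        ultimately have k': "k = s + int k'" "k' \<in> {j * m + 1..j * m + m}" by simp_all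
        have "\<bar>real k' - real i\<bar> \<le> \<tau> * real n" using close[OF k'(2)] m\<tau> by (simp add: abs_le_iff)
        moreover have "k' \<in> {1..n}" using k'(2) jm by auto
        ultimately show "\<not> (y\<^sub>1 < \<epsilon> (k - 1) \<omega> \<and> \<epsilon> k \<omega> \<le> t * y\<^sub>1)" using bad[of k'] k'(1) by simp
      qed
      with j show "\<omega> \<in> (\<Union>j<J. Bad j)" by blast
    qed
    then have "prob ?E \<le> prob (\<Union>j<J. Bad j)" using Bad_sets by (intro finite_measure_mono) auto
    also have "\<dots> \<le> (\<Sum>j<J. prob (Bad j))" using Bad_sets by (intro finite_measure_subadditive_finite) auto
    also have "\<dots> \<le> (\<Sum>j<J. exp (- \<kappa> * t powr a * real (m div 2)))"
      unfolding Bad_def using t by (intro sum_mono block)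
    also have "\<dots> \<le> real J * exp (- (\<kappa> / (8 * real J)) * t powr a * real n)"
    proof -
      \<comment> \<open>The constant 8 is 2 for the tail times 4 for the integer halving of
        \<open>m\<close>.\<close>
      have "real n \<le> real (J * m + J)" using nJ(2) by (simp only: of_nat_le_iff)
      also have "\<dots> \<le> 2 * real J * real m" using \<open>J + 2 \<le> m\<close> J(2) by (simp add: algebra_simps)
      also have "\<dots> \<le> 8 * real J * real (m div 2)"
      proof -
        have "m \<le> 4 * (m div 2)" using \<open>J + 2 \<le> m\<close> by presburger
        then have "real m \<le> 4 * real (m div 2)" by linarith
        then show ?thesis using J(2) by simp
      qed
      finally have "real n / (8 * real J) \<le> real (m div 2)" using J(2) by (simp add: field_simps)
      then have "\<kappa> * t powr a * (real n / (8 * real J)) \<le> \<kappa> * t powr a * real (m div 2)"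
        using pos by (intro mult_left_mono) auto
      then show ?thesis using J(2) by simp
    qed
    finally show ?thesis .
  qed
  with pos J show ?thesis
    by (intro exI[of _ y\<^sub>1] exI[of _ "\<kappa> / (8 * real J)"] exI[of _ "real J"] exI[of _ "J * J + 2 * J"]) auto
qed

section \<open>Almost sure positivity of the innovations and convergence of the discounted
  series\<close>

lemma AE_pos_of_cdf:
  assumes "random_variable borel Y" "cdf (distr M borel Y) = F" "a > 0"
    and near: "\<forall>\<^sub>F y in at_right 0. F y \<le> C * y powr a"
  shows "AE \<omega> in M. 0 < Y \<omega>"
proof -
  note [measurable] = assms(1)
  have F: "F y = prob {\<omega> \<in> space M. Y \<omega> \<le> y}" for y
    using cdf_distr_eq[OF assms(1), of y] assms(2) by simp
  have "((\<lambda>y. C * y powr a) \<longlongrightarrow> C * 0 powr a) (at_right 0)"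
    using \<open>a > 0\<close> by (intro tendsto_intros tendsto_powr2) (auto intro: eventually_mono[OF eventually_at_right_less])
  \<comment> \<open>Monotonicity puts F 0 below C y^a for every small y; letting y tend to 0 removes
    all mass from the nonpositive reals.\<close>
  moreover have "\<forall>\<^sub>F y in at_right 0. F 0 \<le> C * y powr a"
    using near eventually_at_right_less[of 0]
  proof eventually_elim
    case (elim y)
    have "F 0 \<le> F y" unfolding F using elim by (intro finite_measure_mono) auto
    with elim show ?case by linarith
  qed
  ultimately have "F 0 \<le> C * 0 powr a"
    by (intro tendsto_lowerbound) auto
  then have "prob {\<omega> \<in> space M. Y \<omega> \<le> 0} = 0" unfolding F by (simp add: measure_le_0_iff)
  then have "AE \<omega> in M. \<not> Y \<omega> \<le> 0"
    by (subst AE_iff_measurable[OF _ refl]) (auto simp: emeasure_eq_measure)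
  then show ?thesis by eventually_elim simp
qed

text \<open>By Tonelli the series has expectation E / (1 - \<rho>), and a nonnegative variable with
  finite expectation is almost surely finite.\<close>

lemma AE_summable_discounted:
  fixes \<epsilon> :: "int \<Rightarrow> 'a \<Rightarrow> real"
  assumes meas: "\<And>k. random_variable borel (\<epsilon> k)"
    and cdf: "\<And>k. cdf (distr M borel (\<epsilon> k)) = F"
    and pos: "\<And>k. AE \<omega> in M. 0 < \<epsilon> k \<omega>"
    and int: "integrable M (\<lambda>\<omega>. \<epsilon> 1 \<omega> powr p)" and "p \<ge> 1" and \<rho>: "0 < \<rho>" "\<rho> < 1"
  shows "AE \<omega> in M. summable (\<lambda>i. \<rho> ^ i * \<epsilon> (k - int i) \<omega>)"
proof -
  note [measurable] = meas
  have "integrable M (\<epsilon> 1)"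
  proof (rule Bochner_Integration.integrable_bound)
    show "integrable M (\<lambda>\<omega>. 1 + \<epsilon> 1 \<omega> powr p)" using int by simp
    show "AE \<omega> in M. norm (\<epsilon> 1 \<omega>) \<le> norm (1 + \<epsilon> 1 \<omega> powr p)"
      using pos[of 1]
    proof eventually_elim
      case (elim \<omega>)
      have "\<epsilon> 1 \<omega> \<le> 1 + \<epsilon> 1 \<omega> powr p"
      proof (cases "\<epsilon> 1 \<omega> \<le> 1")
        case False
        then have "\<epsilon> 1 \<omega> powr 1 \<le> \<epsilon> 1 \<omega> powr p" using \<open>p \<ge> 1\<close> by (intro powr_mono) auto
        then show ?thesis using elim by simp
      qed (simp add: add_increasing2)
      then show ?case using elim by simp
    qed
  qed simp
  define E where "E = (\<integral>\<^sup>+ \<omega>. ennreal (\<epsilon> 1 \<omega>) \<partial>M)"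
  have "E < \<infinity>"
  proof -
    have "E \<le> (\<integral>\<^sup>+ \<omega>. ennreal (norm (\<epsilon> 1 \<omega>)) \<partial>M)"
      unfolding E_def by (intro nn_integral_mono) (auto intro!: ennreal_leI)
    also have "\<dots> < \<infinity>" using \<open>integrable M (\<epsilon> 1)\<close> by (simp add: integrable_iff_bounded)
    finally show ?thesis .
  qed
  have E: "(\<integral>\<^sup>+ \<omega>. ennreal (\<epsilon> k \<omega>) \<partial>M) = E" for k
  proof -
    \<comment> \<open>The moment condition concerns index 1; equal distribution functions give equal
      laws and carry it to every index.\<close>
    have "distr M borel (\<epsilon> k) = distr M borel (\<epsilon> 1)"
      using meas by (intro cdf_unique real_distribution_distr) (auto simp: cdf)
    then have "(\<integral>\<^sup>+ y. ennreal y \<partial>distr M borel (\<epsilon> k)) = (\<integral>\<^sup>+ y. ennreal y \<partial>distr M borel (\<epsilon> 1))" by simp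
    then show ?thesis unfolding E_def by (simp add: nn_integral_distr)
  qed
  have "(\<integral>\<^sup>+ \<omega>. (\<Sum>i. ennreal (\<rho> ^ i * \<epsilon> (k - int i) \<omega>)) \<partial>M) = (\<Sum>i. \<integral>\<^sup>+ \<omega>. ennreal (\<rho> ^ i * \<epsilon> (k - int i) \<omega>) \<partial>M)"
    by (intro nn_integral_suminf) auto
  also have "\<dots> = (\<Sum>i. ennreal (\<rho> ^ i) * E)"
    using \<rho> by (simp add: ennreal_mult' nn_integral_cmult E)
  also have "\<dots> = ennreal (1 / (1 - \<rho>)) * E"
    using \<rho> by (simp add: ennreal_suminf_multc suminf_ennreal2 suminf_geometric summable_geometric)
  also have "\<dots> < \<infinity>" using \<open>E < \<infinity>\<close> by (simp add: ennreal_mult_less_top)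
  finally have "AE \<omega> in M. (\<Sum>i. ennreal (\<rho> ^ i * \<epsilon> (k - int i) \<omega>)) \<noteq> \<infinity>"
    by (intro nn_integral_PInf_AE) auto
  moreover have "AE \<omega> in M. \<forall>k. 0 < \<epsilon> k \<omega>" using pos by (simp add: AE_all_countable)
  ultimately show ?thesis
  proof eventually_elim
    case (elim \<omega>)
    then show ?case using \<rho> by (intro summable_suminf_not_top) (auto intro: less_imp_le)
  qed
qed

end

section \<open>The autoregressive process\<close>

lemma const_ext_mem:
  assumes "f \<in> coeff_class L \<beta> \<rho>"
  shows "const_ext f u \<in> {0..\<rho>}"
  using assms by (auto simp: coeff_class_def const_ext_def)

text \<open>The process is defined by its series, so the recursion has to be recovered: splitting
  off the term i = 0 and pulling out the common coefficient at time k leaves the series for time k -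
  1. Domination by \<rho>^i gives convergence, without which the value of \<open>suminf\<close> is
  unspecified.\<close>

lemma tv_ar_recursion:
  fixes \<epsilon> :: "int \<Rightarrow> 'a \<Rightarrow> real"
  assumes f: "f \<in> coeff_class L \<beta> \<rho>" and pos: "\<And>k. 0 < \<epsilon> k \<omega>"
    and summ: "\<And>k. summable (\<lambda>i. \<rho> ^ i * \<epsilon> (k - int i) \<omega>)"
  shows "tv_ar f \<epsilon> N k \<omega> = const_ext f (real_of_int k / real N) * tv_ar f \<epsilon> N (k - 1) \<omega> + \<epsilon> k \<omega>"
    and "\<epsilon> k \<omega> \<le> tv_ar f \<epsilon> N k \<omega>"
proof -
  define w where "w k i = (\<Prod>l<i. const_ext f (real_of_int (k - int l) / real N))" for k i
  have w: "0 \<le> w k i" "w k i \<le> \<rho> ^ i" for k i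
  proof -
    show "0 \<le> w k i" unfolding w_def using const_ext_mem[OF f] by (intro prod_nonneg) auto
    have "w k i \<le> (\<Prod>l<i. \<rho>)" unfolding w_def using const_ext_mem[OF f] by (intro prod_mono) auto
    then show "w k i \<le> \<rho> ^ i" by simp
  qed
  have X: "tv_ar f \<epsilon> N k \<omega> = (\<Sum>i. w k i * \<epsilon> (k - int i) \<omega>)" for k
    by (simp add: tv_ar_def w_def)
  have S: "summable (\<lambda>i. w k i * \<epsilon> (k - int i) \<omega>)" for k
    by (rule summable_comparison_test'[OF summ[of k]])
       (use w pos in \<open>auto simp: abs_mult less_imp_le intro!: mult_right_mono\<close>)
  have nonneg: "0 \<le> tv_ar f \<epsilon> N k \<omega>" for k
    unfolding X using w pos by (intro suminf_nonneg S) (simp add: less_imp_le)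
  have w_Suc: "w k (Suc i) = const_ext f (real_of_int k / real N) * w (k - 1) i" for i
    unfolding w_def by (subst prod.lessThan_Suc_shift) (simp add: algebra_simps)
  have "tv_ar f \<epsilon> N k \<omega> = (\<Sum>i. w k (Suc i) * \<epsilon> (k - int (Suc i)) \<omega>) + w k 0 * \<epsilon> k \<omega>"
    unfolding X using suminf_split_head[OF S[of k]] by simp
  also have "(\<lambda>i. w k (Suc i) * \<epsilon> (k - int (Suc i)) \<omega>)
      = (\<lambda>i. const_ext f (real_of_int k / real N) * (w (k - 1) i * \<epsilon> (k - 1 - int i) \<omega>))"
    by (simp add: w_Suc algebra_simps)
  also have "(\<Sum>i. const_ext f (real_of_int k / real N) * (w (k - 1) i * \<epsilon> (k - 1 - int i) \<omega>))
      = const_ext f (real_of_int k / real N) * tv_ar f \<epsilon> N (k - 1) \<omega>"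
    unfolding X using S[of "k - 1"] by (rule suminf_mult)
  finally show *: "tv_ar f \<epsilon> N k \<omega> = const_ext f (real_of_int k / real N) * tv_ar f \<epsilon> N (k - 1) \<omega> + \<epsilon> k \<omega>"
    by (simp add: w_def)
  show "\<epsilon> k \<omega> \<le> tv_ar f \<epsilon> N k \<omega>"
    unfolding * using const_ext_mem[OF f] nonneg by simp
qed


section \<open>The estimation error\<close>

text \<open>If N x were below s or above s + n + 1, that index would be nearer to N x than an end of
  the window, and 0 \<le> x \<le> 1 would place it in {1..N}, so it would belong to the window as
  well. Hence N x is between s and s + n + 1, and n + 1 \<le> 2 n.\<close>

lemma window_eq_interval:
  assumes x: "0 \<le> x" "x \<le> 1" and "N \<ge> 1" and n: "n = card (window N h x)" "n \<ge> 1"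
  shows "\<exists>s. window N h x = {s + 1..s + n} \<and> \<bar>real N * x - real s\<bar> \<le> 2 * real n"
proof -
  have mem: "k \<in> window N h x \<longleftrightarrow> 1 \<le> k \<and> k \<le> N \<and> \<bar>real k - real N * x\<bar> \<le> real N * h" for k
  proof -
    have "\<bar>real k - real N * x\<bar> = real N * \<bar>real k / real N - x\<bar>"
    proof -
      have "real k - real N * x = real N * (real k / real N - x)"
        using \<open>N \<ge> 1\<close> by (simp add: algebra_simps)
      then show ?thesis by (simp only: abs_mult abs_of_nat)
    qed
    then show ?thesis using \<open>N \<ge> 1\<close> by (simp add: window_def)
  qed
  have fin: "finite (window N h x)" by (simp add: window_def)
  have ne: "window N h x \<noteq> {}" using n by auto
  define a where "a = Min (window N h x)"
  define b where "b = Max (window N h x)"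
  have a: "a \<in> window N h x" "\<And>k. k \<in> window N h x \<Longrightarrow> a \<le> k"
    and b: "b \<in> window N h x" "\<And>k. k \<in> window N h x \<Longrightarrow> k \<le> b"
    using fin ne by (auto simp: a_def b_def)
  have W: "window N h x = {a..b}"
  proof
    show "{a..b} \<subseteq> window N h x"
    proof
      fix k assume "k \<in> {a..b}"
      then have "real a \<le> real k" "real k \<le> real b" "1 \<le> k" "k \<le> N" using a(1) b(1) by (auto simp: mem)
      then show "k \<in> window N h x" using a(1) b(1) unfolding mem abs_le_iff by linarith
    qed
  qed (use a b in auto)
  define s where "s = a - 1"
  have as: "a = s + 1" using a(1) by (simp add: s_def mem)
  have bn: "b = s + n" using n W as by auto
  have Nx: "0 \<le> real N * x" "real N * x \<le> real N" using x by (auto simp: mult_left_le)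
  have "real s \<le> real N * x"
  proof (rule ccontr)
    assume c: "\<not> real s \<le> real N * x"
    then have "0 < real s" using Nx by linarith
    then have "s \<in> window N h x" using a(1) c as by (auto simp: mem abs_le_iff)
    then show False using a(2)[of s] as by simp
  qed
  moreover have "real N * x \<le> real b + 1"
  proof (rule ccontr)
    assume c: "\<not> real N * x \<le> real b + 1"
    then have "real (b + 1) \<le> real N" using Nx by simp
    then have "b + 1 \<le> N" by (simp only: of_nat_le_iff)
    then have "b + 1 \<in> window N h x" using b(1) c by (auto simp: mem abs_le_iff)
    then show False using b(2)[of "b + 1"] by simp
  qed
  ultimately have "\<bar>real N * x - real s\<bar> \<le> 2 * real n" using bn \<open>n \<ge> 1\<close> by simp
  then show ?thesis using W as bn by auto
qed

lemma local_poly_eq: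
  "local_poly \<beta> x b y = (\<Sum>i\<le>nat \<lfloor>\<beta> + 1\<rfloor>. b i * (y - x) ^ i)" if "\<beta> > 0"
proof -
  have "{i. real i \<le> \<beta> + 1} = {..nat \<lfloor>\<beta> + 1\<rfloor>}"
    using that by (auto simp: le_nat_iff) linarith+
  then show ?thesis by (simp add: local_poly_def)
qed

text \<open>The Taylor polynomial has degree below \<beta>, so padding its coefficients with zeros
  puts it among the polynomials over which the estimator maximises.\<close>

lemma hoelder_local_poly_approx:
  assumes f: "f \<in> hoelder_class S L \<beta>" and S: "convex S" "x \<in> S" and "L \<ge> 0" and "\<beta> > 0"
  shows "\<exists>b. b 0 = f x \<and> (\<forall>y\<in>S. \<bar>f y - local_poly \<beta> x b y\<bar> \<le> L * \<bar>y - x\<bar> powr \<beta>)"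
proof -
  define m where "m = hoelder_order \<beta>"
  have m: "real m < \<beta>" using hoelder_order_less[OF \<open>\<beta> > 0\<close>] by (simp add: m_def)
  obtain D where D0: "D 0 = f"
    and deriv: "\<And>i y. i < m \<Longrightarrow> y \<in> S \<Longrightarrow> (D i has_real_derivative D (Suc i) y) (at y within S)"
    and top: "\<And>y z. y \<in> S \<Longrightarrow> z \<in> S \<Longrightarrow> \<bar>D m y - D m z\<bar> \<le> L * \<bar>y - z\<bar> powr (\<beta> - real m)"
    using f unfolding hoelder_class_def m_def by blast
  define b where "b i = (if i \<le> m then D i x / fact i else 0)" for i
  have "m \<le> nat \<lfloor>\<beta> + 1\<rfloor>" using m by linarith
  then have "local_poly \<beta> x b y = (\<Sum>j\<le>m. D j x / fact j * (y - x) ^ j)" for y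
    unfolding local_poly_eq[OF \<open>\<beta> > 0\<close>]
    by (intro sum.mono_neutral_cong_right) (auto simp: b_def)
  moreover have "\<bar>D 0 y - (\<Sum>j\<le>m. D j x / fact j * (y - x) ^ j)\<bar> \<le> L * \<bar>y - x\<bar> powr \<beta>" if "y \<in> S" for y
    using taylor_remainder_powr_bound[OF S \<open>L \<ge> 0\<close> m deriv top[OF _ S(2)] that] .
  ultimately show ?thesis
    by (intro exI[of _ b]) (simp add: D0 b_def)
qed

text \<open>The deterministic half of the argument: randomness will enter only through the two
  conditions that compare \<open>Y\<close> with \<open>f\<close>. The constants precede all data and
  depend on \<beta> alone.\<close>

lemma qmle_error_le:
  assumes "\<beta> > 0"
  shows "\<exists>\<tau> K n\<^sub>0. \<tau> > 0 \<and> K > 0 \<and> (\<forall>f x L N h Y r s n t.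
      0 \<le> x \<longrightarrow> x \<le> 1 \<longrightarrow> 0 \<le> L \<longrightarrow> f \<in> hoelder_class {0..1} L \<beta> \<longrightarrow> N \<ge> 1 \<longrightarrow>
      window N h x = {s + 1..s + n} \<longrightarrow> \<bar>real N * x - real s\<bar> \<le> 2 * real n \<longrightarrow> n \<ge> n\<^sub>0 \<longrightarrow> 0 \<le> h \<longrightarrow>
      (\<forall>k\<in>window N h x. f (real k / real N) \<le> Y k) \<longrightarrow>
      (\<forall>i\<in>{1..n}. \<exists>k\<in>{1..n}. \<bar>real k - real i\<bar> \<le> \<tau> * real n \<and> Y (s + k) \<le> f (real (s + k) / real N) + t) \<longrightarrow>
      is_local_poly_qmle \<beta> N h x Y r \<longrightarrow>
      \<bar>r - f x\<bar> \<le> K * (t + L * h powr \<beta>))"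
proof -
  define d where "d = nat \<lfloor>\<beta> + 1\<rfloor>"
  obtain \<tau> K n\<^sub>0 where "\<tau> > 0" "K > 0" and coeff:
    "\<And>n (p :: real poly) t i. n \<ge> n\<^sub>0 \<Longrightarrow> degree p \<le> d \<Longrightarrow>
      (\<forall>i\<in>{1..n}. \<exists>k\<in>{1..n}. \<bar>real k - real i\<bar> \<le> \<tau> * real n \<and> poly p (real k / real n) \<le> t) \<Longrightarrow>
      0 \<le> (\<Sum>k=1..n. poly p (real k / real n)) \<Longrightarrow> \<bar>coeff p i\<bar> \<le> K * t"
    using coeff_bound_of_one_sided_control[of d] by blast
  \<comment> \<open>There are at most d + 1 terms, each with |z|^i \<le> 2^d and coefficient at most
    K (t + 2 H). The factor 2 covers 2 H, and the added 1 covers the shift by H.\<close>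
  define K' where "K' = 2 * ((real d + 1) * 2 ^ d * K) + 1"
  have main: "\<bar>r - f x\<bar> \<le> K' * (t + L * h powr \<beta>)"
    if x: "0 \<le> x" "x \<le> 1" and L: "0 \<le> L" and f: "f \<in> hoelder_class {0..1} L \<beta>" and N: "N \<ge> 1"
      and W: "window N h x = {s + 1..s + n}" and Nx: "\<bar>real N * x - real s\<bar> \<le> 2 * real n"
      and n: "n \<ge> n\<^sub>0" "n \<ge> 1" and h: "0 \<le> h"
      and below: "\<And>k. k \<in> window N h x \<Longrightarrow> f (real k / real N) \<le> Y k"
      and close: "\<forall>i\<in>{1..n}. \<exists>k\<in>{1..n}. \<bar>real k - real i\<bar> \<le> \<tau> * real n \<and> Y (s + k) \<le> f (real (s + k) / real N) + t"
      and r: "is_local_poly_qmle \<beta> N h x Y r"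
    for f x L N h Y r s n t
  proof -
    define H where "H = L * h powr \<beta>"
    have "H \<ge> 0" using L by (simp add: H_def)
    obtain b\<^sub>1 where b1: "b\<^sub>1 0 = f x" "\<And>y. y \<in> {0..1} \<Longrightarrow> \<bar>f y - local_poly \<beta> x b\<^sub>1 y\<bar> \<le> L * \<bar>y - x\<bar> powr \<beta>"
      using hoelder_local_poly_approx[OF f _ _ L \<open>\<beta> > 0\<close>, of x] x by auto
    define b' where "b' = b\<^sub>1(0 := b\<^sub>1 0 - H)"
    have b': "local_poly \<beta> x b' y = local_poly \<beta> x b\<^sub>1 y - H" for y
      unfolding local_poly_eq[OF \<open>\<beta> > 0\<close>] by (simp add: b'_def sum.atMost_shift)
    have approx: "local_poly \<beta> x b' (real k / real N) \<le> f (real k / real N)"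
      "f (real k / real N) \<le> local_poly \<beta> x b' (real k / real N) + 2 * H" if "k \<in> window N h x" for k
    proof -
      have "\<bar>real k / real N - x\<bar> powr \<beta> \<le> h powr \<beta>"
        using that \<open>\<beta> > 0\<close> by (intro powr_mono2) (auto simp: window_def)
      then have "L * \<bar>real k / real N - x\<bar> powr \<beta> \<le> H" unfolding H_def using L by (intro mult_left_mono)
      moreover have "real k / real N \<in> {0..1}" using that by (auto simp: window_def)
      ultimately have "\<bar>f (real k / real N) - local_poly \<beta> x b\<^sub>1 (real k / real N)\<bar> \<le> H"
        using b1(2) by fastforce
      then show "local_poly \<beta> x b' (real k / real N) \<le> f (real k / real N)"
        "f (real k / real N) \<le> local_poly \<beta> x b' (real k / real N) + 2 * H"
        unfolding b' by linarith+
    qed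
    obtain b where feas: "qml_feasible \<beta> N h x Y b" and r0: "r = b 0"
      and opt: "\<And>b'. qml_feasible \<beta> N h x Y b' \<Longrightarrow> qml_objective \<beta> N h x b' \<le> qml_objective \<beta> N h x b"
      using r by (auto simp: is_local_poly_qmle_def)
    have "qml_feasible \<beta> N h x Y b'"
      unfolding qml_feasible_def using approx(1) below order_trans by blast
    then have opt': "qml_objective \<beta> N h x b' \<le> qml_objective \<beta> N h x b" by (rule opt)
    \<comment> \<open>The difference of the maximiser and the lowered Taylor polynomial in the
      coordinate z given by y = (s + n z) / N, in which the design point (s + k) / N becomes k /
      n.\<close>
    define P where "P = (\<Sum>i\<le>d. smult (b i - b' i) ([:real s / real N - x, real n / real N:] ^ i))"
    have degP: "degree P \<le> d"
    proof -
      have "degree (smult (b i - b' i) ([:real s / real N - x, real n / real N:] ^ i)) \<le> d" if "i \<le> d" for i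
      proof -
        have "degree ([:real s / real N - x, real n / real N:] ^ i) \<le> degree [:real s / real N - x, real n / real N:] * i"
          by (rule degree_power_le)
        also have "\<dots> \<le> 1 * i" by (intro mult_right_mono) auto
        finally show ?thesis using that by (intro order_trans[OF degree_smult_le]) simp
      qed
      then show ?thesis unfolding P_def by (intro degree_sum_le) auto
    qed
    have P: "poly P z = local_poly \<beta> x b ((real s + real n * z) / real N) - local_poly \<beta> x b' ((real s + real n * z) / real N)" for z
    proof -
      have "poly [:real s / real N - x, real n / real N:] z = (real s + real n * z) / real N - x"
        by (simp add: add_divide_distrib)
      then show ?thesis
        unfolding P_def local_poly_eq[OF \<open>\<beta> > 0\<close>] d_def[symmetric]
        by (simp only: poly_sum poly_smult poly_power left_diff_distrib sum_subtractf)
    qed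
    have Pk: "poly P (real k / real n) = local_poly \<beta> x b (real (s + k) / real N) - local_poly \<beta> x b' (real (s + k) / real N)" for k
      unfolding P using n(2) by simp
    have coeffP: "\<bar>coeff P i\<bar> \<le> K * (t + 2 * H)" for i
    proof (rule coeff[OF n(1) degP])
      show "\<forall>i\<in>{1..n}. \<exists>k\<in>{1..n}. \<bar>real k - real i\<bar> \<le> \<tau> * real n \<and> poly P (real k / real n) \<le> t + 2 * H"
      proof
        fix i assume "i \<in> {1..n}"
        then obtain k where k: "k \<in> {1..n}" "\<bar>real k - real i\<bar> \<le> \<tau> * real n" "Y (s + k) \<le> f (real (s + k) / real N) + t"
          using close by blast
        have kW: "s + k \<in> window N h x" using k(1) W by auto
        then have "local_poly \<beta> x b (real (s + k) / real N) \<le> Y (s + k)"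
          using feas by (auto simp: qml_feasible_def)
        then have "poly P (real k / real n) \<le> t + 2 * H"
          unfolding Pk using approx(2)[OF kW] k(3) by linarith
        with k show "\<exists>k\<in>{1..n}. \<bar>real k - real i\<bar> \<le> \<tau> * real n \<and> poly P (real k / real n) \<le> t + 2 * H" by blast
      qed
      have "(\<Sum>k=1..n. poly P (real k / real n)) = (\<Sum>k=s + 1..s + n. local_poly \<beta> x b (real k / real N) - local_poly \<beta> x b' (real k / real N))"
        unfolding Pk by (rule sum.reindex_bij_witness[where i = "\<lambda>k. k - s" and j = "\<lambda>k. s + k"]) auto
      also have "\<dots> = qml_objective \<beta> N h x b - qml_objective \<beta> N h x b'"
        by (simp add: qml_objective_def W sum_subtractf)
      finally show "0 \<le> (\<Sum>k=1..n. poly P (real k / real n))" using opt' by simp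
    qed
    \<comment> \<open>The point \<open>x\<close> in this coordinate; it may lie outside the unit
      interval, hence the powers of 2 below.\<close>
    define z where "z = (real N * x - real s) / real n"
    have z: "\<bar>z\<bar> \<le> 2" using Nx n(2) by (simp add: z_def field_simps)
    have xz: "(real s + real n * z) / real N = x" using N n(2) by (simp add: z_def)
    have "poly P z = b 0 - b' 0"
      unfolding P xz unfolding local_poly_eq[OF \<open>\<beta> > 0\<close>] by (simp add: sum.atMost_shift)
    then have Pz: "poly P z = r - f x + H" by (simp add: r0 b'_def b1)
    have T: "0 \<le> K * (t + 2 * H)" using coeffP[of 0] by linarith
    have "\<bar>poly P z\<bar> = \<bar>\<Sum>i\<le>degree P. coeff P i * z ^ i\<bar>" by (simp add: poly_altdef)
    also have "\<dots> \<le> (\<Sum>i\<le>degree P. \<bar>coeff P i * z ^ i\<bar>)" by (rule sum_abs)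
    also have "\<dots> \<le> (\<Sum>i\<le>degree P. K * (t + 2 * H) * 2 ^ d)"
    proof (rule sum_mono)
      fix i assume "i \<in> {..degree P}"
      have "\<bar>z\<bar> ^ i \<le> 2 ^ i" using z by (intro power_mono) auto
      also have "\<dots> \<le> 2 ^ d" using \<open>i \<in> {..degree P}\<close> degP by (intro power_increasing) auto
      finally show "\<bar>coeff P i * z ^ i\<bar> \<le> K * (t + 2 * H) * 2 ^ d"
        unfolding abs_mult power_abs using coeffP[of i] T by (intro mult_mono) auto
    qed
    also have "\<dots> = (real (degree P) + 1) * (K * (t + 2 * H) * 2 ^ d)" by simp
    also have "\<dots> \<le> (real d + 1) * (K * (t + 2 * H) * 2 ^ d)"
      using degP T by (intro mult_right_mono) auto
    finally have "\<bar>r - f x + H\<bar> \<le> (real d + 1) * 2 ^ d * K * (t + 2 * H)" unfolding Pz by (simp add: algebra_simps)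
    then have "\<bar>r - f x\<bar> \<le> (real d + 1) * 2 ^ d * K * (t + 2 * H) + H" using \<open>H \<ge> 0\<close> by linarith
    also have "\<dots> \<le> K' * (t + H)"
    proof -
      define Q where "Q = (real d + 1) * 2 ^ d * K"
      have "Q > 0" using \<open>K > 0\<close> by (simp add: Q_def add_nonneg_pos)
      \<comment> \<open>At some design point f \<le> Y \<le> f + t; such a point exists because the
        window is nonempty.\<close>
      have "0 \<le> t"
      proof -
        obtain k where k: "k \<in> {1..n}" "Y (s + k) \<le> f (real (s + k) / real N) + t"
          using close n(2) by fastforce
        then have "s + k \<in> window N h x" using W by auto
        from below[OF this] k show ?thesis by linarith
      qed
      then have "0 \<le> Q * t + t" using \<open>Q > 0\<close> by simp
      then show ?thesis unfolding K'_def Q_def[symmetric] by (simp add: algebra_simps)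
    qed
    finally show ?thesis unfolding H_def .
  qed
  have "K' > 0" using \<open>K > 0\<close> by (simp add: K'_def add_nonneg_pos)
  show ?thesis
  proof (rule exI[of _ \<tau>], rule exI[of _ K'], rule exI[of _ "max n\<^sub>0 1"], intro conjI allI impI)
    fix f x L N h Y r s n t
    assume "0 \<le> x" "x \<le> 1" "0 \<le> L" "f \<in> hoelder_class {0..1} L \<beta>" "N \<ge> 1"
      "window N h x = {s + 1..s + n}" "\<bar>real N * x - real s\<bar> \<le> 2 * real n" "n \<ge> max n\<^sub>0 1" "0 \<le> h"
      "\<forall>k\<in>window N h x. f (real k / real N) \<le> Y k"
      "\<forall>i\<in>{1..n}. \<exists>k\<in>{1..n}. \<bar>real k - real i\<bar> \<le> \<tau> * real n \<and> Y (s + k) \<le> f (real (s + k) / real N) + t"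
      "is_local_poly_qmle \<beta> N h x Y r"
    then show "\<bar>r - f x\<bar> \<le> K' * (t + L * h powr \<beta>)"
      by (intro main[where N = N and Y = Y and s = s and n = n]) auto
  qed fact+
qed


section \<open>Choice of constants and the uniform deviation bound\<close>

lemma zero_mem_coeff_class: "(\<lambda>_. 0) \<in> coeff_class L \<beta> \<rho>" if "0 \<le> L" "0 \<le> \<rho>"
  using that unfolding coeff_class_def hoelder_class_def
  by (auto intro!: exI[of _ "\<lambda>_ _. 0"])

text \<open>The constants are quantified before \<open>fhat\<close>, so one bound serves every
  measurable choice among the maximisers.\<close>

theorem theorem2p1:
  fixes M :: "'w measure" and \<epsilon> :: "int \<Rightarrow> 'w \<Rightarrow> real"
    and F g :: "real \<Rightarrow> real"
    and x L \<beta> \<rho> \<aa> \<cc> \<cc>\<^sub>g \<delta> L\<^sub>\<epsilon> \<beta>\<^sub>\<epsilon> :: real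
  assumes "0 \<le> x" "x \<le> 1"
    and "L > 0" "\<beta> > 0" "0 < \<rho>" "\<rho> < 1"
    and "\<aa> > 0" "\<cc> > 0" "\<cc>\<^sub>g > 0" "\<delta> > 0" "L\<^sub>\<epsilon> > 0" "\<beta>\<^sub>\<epsilon> > 0"
    and "prob_space M"
    and "prob_space.indep_vars M (\<lambda>_. borel) \<epsilon> UNIV"
    and "\<And>k. cdf (distr M borel (\<epsilon> k)) = F"
    and "\<forall>\<^sub>F y in at_right 0. F y = \<cc> * y powr \<aa> + g y \<and> \<bar>g y\<bar> \<le> \<cc>\<^sub>g * y powr (\<aa> + \<delta>)"
    and "F \<in> hoelder_class {0..} L\<^sub>\<epsilon> \<beta>\<^sub>\<epsilon>"
    and "integrable M (\<lambda>\<omega>. \<epsilon> 1 \<omega> powr (max 1 (2 * \<aa> + \<delta>)))"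
  shows "\<exists>c\<^sub>1 c\<^sub>2 c\<^sub>3 \<nu> :: real. c\<^sub>1 > 0 \<and> c\<^sub>2 > 0 \<and> c\<^sub>3 > 0 \<and> \<nu> > 0 \<and>
    (\<forall>(N :: nat) (h :: real) (v :: real) fhat.
       N \<ge> 1 \<longrightarrow> h > 0 \<longrightarrow> 0 \<le> v \<longrightarrow> v \<le> real (card (window N h x)) powr \<nu> \<longrightarrow>
       is_qml_estimator M \<epsilon> \<beta> N h x (coeff_class L \<beta> \<rho>) fhat \<longrightarrow>
       (SUP f \<in> coeff_class L \<beta> \<rho>.
          measure M {\<omega> \<in> space M. \<bar>fhat f \<omega> - f x\<bar>
             \<ge> c\<^sub>1 * h powr \<beta> + c\<^sub>2 * real (card (window N h x)) powr (- 1 / \<aa>) * v})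
         \<le> c\<^sub>3 * exp (- (v powr \<aa>)))"
proof -
  interpret prob_space M by fact
  note indep = \<open>indep_vars (\<lambda>_. borel) \<epsilon> UNIV\<close> and cdf = assms(15)
  have meas [measurable]: "\<epsilon> k \<in> borel_measurable M" for k
    using indep by (auto simp: indep_vars_def)
  have near: "\<forall>\<^sub>F y in at_right 0. \<cc> / 2 * y powr \<aa> \<le> F y \<and> F y \<le> 2 * \<cc> * y powr \<aa>"
    using assms by (intro power_law_bounds_at_right[where C = \<cc>\<^sub>g and g = g and \<delta> = \<delta>]) auto
  have pos: "AE \<omega> in M. 0 < \<epsilon> k \<omega>" for k
    using near by (intro AE_pos_of_cdf[OF meas cdf \<open>\<aa> > 0\<close>, where C = "2 * \<cc>"]) (auto elim: eventually_mono)
  have "AE \<omega> in M. summable (\<lambda>i. \<rho> ^ i * \<epsilon> (k - int i) \<omega>)" for k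
    using assms pos by (intro AE_summable_discounted[OF meas cdf]) auto
  with pos have regular: "AE \<omega> in M. (\<forall>k. 0 < \<epsilon> k \<omega>) \<and> (\<forall>k. summable (\<lambda>i. \<rho> ^ i * \<epsilon> (k - int i) \<omega>))"
    by (simp add: AE_all_countable AE_conj_iff)
  obtain \<tau> K n\<^sub>1 where "\<tau> > 0" "K > 0" and error:
    "\<And>f x L N h Y r s n t.
      0 \<le> x \<Longrightarrow> x \<le> 1 \<Longrightarrow> 0 \<le> L \<Longrightarrow> f \<in> hoelder_class {0..1} L \<beta> \<Longrightarrow> N \<ge> 1 \<Longrightarrow>
      window N h x = {s + 1..s + n} \<Longrightarrow> \<bar>real N * x - real s\<bar> \<le> 2 * real n \<Longrightarrow> n \<ge> n\<^sub>1 \<Longrightarrow> 0 \<le> h \<Longrightarrow>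
      \<forall>k\<in>window N h x. f (real k / real N) \<le> Y k \<Longrightarrow>
      \<forall>i\<in>{1..n}. \<exists>k\<in>{1..n}. \<bar>real k - real i\<bar> \<le> \<tau> * real n \<and> Y (s + k) \<le> f (real (s + k) / real N) + t \<Longrightarrow>
      is_local_poly_qmle \<beta> N h x Y r \<Longrightarrow>
      \<bar>r - f x\<bar> \<le> K * (t + L * h powr \<beta>)"
    using qmle_error_le[OF \<open>\<beta> > 0\<close>] by blast
  obtain y\<^sub>1 \<kappa> C n\<^sub>2 where "y\<^sub>1 > 0" "\<kappa> > 0" "C > 0" and gap:
    "\<And>t s n. 0 < t \<Longrightarrow> t \<le> 1 \<Longrightarrow> n \<ge> n\<^sub>2 \<Longrightarrow>
     prob {\<omega> \<in> space M. \<exists>i\<in>{1..n}. \<forall>k\<in>{1..n}. \<bar>real k - real i\<bar> \<le> \<tau> * real n \<longrightarrow>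
         \<not> (y\<^sub>1 < \<epsilon> (s + int k - 1) \<omega> \<and> \<epsilon> (s + int k) \<omega> \<le> t * y\<^sub>1)}
       \<le> C * exp (- \<kappa> * t powr \<aa> * real n)"
    using prob_small_ratio_gap_le[OF indep cdf \<open>\<aa> > 0\<close> \<open>\<cc> > 0\<close> near \<open>\<tau> > 0\<close>] by blast
  \<comment> \<open>Normalised so that t = \<mu> n^(-1/\<aa>) v turns the exponent \<kappa> t^\<aa>
    n into exactly v^\<aa>.\<close>
  define \<mu> where "\<mu> = \<kappa> powr (- 1 / \<aa>)"
  have \<mu>: "\<mu> > 0" "\<kappa> * \<mu> powr \<aa> = 1"
    using \<open>\<kappa> > 0\<close> \<open>\<aa> > 0\<close> by (simp_all add: \<mu>_def powr_powr powr_neg_one del: powr_minus)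
  \<comment> \<open>Half of 1/\<aa>: once \<mu> \<le> n^\<nu>, the bound v \<le> n^\<nu> gives t
    \<le> n^\<nu> n^(-1/\<aa>) n^\<nu> = 1. The last entry in the definition of
    \<open>n\<^sub>3\<close> is the condition \<mu> \<le> n^\<nu>.\<close>
  define \<nu> where "\<nu> = 1 / (2 * \<aa>)"
  have "\<nu> > 0" using \<open>\<aa> > 0\<close> by (simp add: \<nu>_def)
  define n\<^sub>3 where "n\<^sub>3 = Suc (max (max n\<^sub>1 n\<^sub>2) (nat \<lceil>\<mu> powr (1 / \<nu>)\<rceil>))"
  \<comment> \<open>\<open>C\<close> serves the main case. The other summands make the claimed bound
    at least 1 when n < \<open>n\<^sub>3\<close> (including an empty window) and when v = 0, a case
    split off because t must be positive.\<close>
  define c\<^sub>3 where "c\<^sub>3 = C + exp 1 + exp (real n\<^sub>3)"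
  \<comment> \<open>The added 1 makes the error strictly smaller than the threshold, as the
    deviation event is defined with \<ge>.\<close>
  define c\<^sub>1 where "c\<^sub>1 = K * L + 1"
  define c\<^sub>2 where "c\<^sub>2 = K * \<mu>"
  have "c\<^sub>1 > 0" "c\<^sub>2 > 0" "c\<^sub>3 > 0"
    using \<open>K > 0\<close> \<open>L > 0\<close> \<open>C > 0\<close> \<mu> by (simp_all add: c\<^sub>1_def c\<^sub>2_def c\<^sub>3_def add_pos_pos)
  have bound: "prob {\<omega> \<in> space M. \<bar>fhat f \<omega> - f x\<bar>
             \<ge> c\<^sub>1 * h powr \<beta> + c\<^sub>2 * real (card (window N h x)) powr (- 1 / \<aa>) * v}
         \<le> c\<^sub>3 * exp (- (v powr \<aa>))" (is "prob ?E \<le> _")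
    if N: "N \<ge> 1" and h: "h > 0" and v: "0 \<le> v" "v \<le> real (card (window N h x)) powr \<nu>"
      and est: "is_qml_estimator M \<epsilon> \<beta> N h x (coeff_class L \<beta> \<rho>) fhat" and f: "f \<in> coeff_class L \<beta> \<rho>"
    for N h v fhat f
  proof -
    define n where "n = card (window N h x)"
    have va: "v powr \<aa> \<le> real n powr (1 / 2)"
    proof -
      have "v powr \<aa> \<le> (real n powr \<nu>) powr \<aa>"
        using v \<open>\<aa> > 0\<close> unfolding n_def by (intro powr_mono2) auto
      also have "\<dots> = real n powr (1 / 2)" using \<open>\<aa> > 0\<close> by (simp add: powr_powr \<nu>_def)
      finally show ?thesis .
    qed
    have trivial: ?thesis if "exp (v powr \<aa>) \<le> c\<^sub>3"
    proof -
      have "1 = exp (v powr \<aa>) * exp (- (v powr \<aa>))" by (simp flip: exp_add)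
      also have "\<dots> \<le> c\<^sub>3 * exp (- (v powr \<aa>))" using that by (intro mult_right_mono) auto
      finally show ?thesis using prob_le_1[of ?E] by linarith
    qed
    consider "n < n\<^sub>3" | "v = 0" | "n \<ge> n\<^sub>3" "v > 0" using v by linarith
    then show ?thesis
    proof cases
      case 1
      have "v powr \<aa> \<le> real n\<^sub>3"
      proof (cases "n = 0")
        case False
        then have "real n powr (1 / 2) \<le> real n powr 1" by (intro powr_mono) auto
        then show ?thesis using va 1 by simp
      qed (use va in simp)
      then have "exp (v powr \<aa>) \<le> exp (real n\<^sub>3)" by simp
      also have "\<dots> \<le> c\<^sub>3" using \<open>C > 0\<close> by (simp add: c\<^sub>3_def add_nonneg_nonneg)
      finally show ?thesis by (rule trivial)
    next
      case 2
      have "exp (v powr \<aa>) = exp 0" using 2 by simp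
      also have "\<dots> \<le> exp 1" by (subst exp_le_cancel_iff) simp
      also have "\<dots> \<le> c\<^sub>3" using \<open>C > 0\<close> by (simp add: c\<^sub>3_def add_nonneg_nonneg)
      finally show ?thesis by (rule trivial)
    next
      case 3
      have n: "n \<ge> n\<^sub>1" "n \<ge> n\<^sub>2" "n \<ge> 1" "\<mu> powr (1 / \<nu>) \<le> real n"
        using 3(1) by (auto simp: n\<^sub>3_def) linarith
      define t where "t = \<mu> * real n powr (- 1 / \<aa>) * v"
      have "t > 0" using \<mu> n(3) 3(2) by (simp add: t_def)
      have "t \<le> 1"
      proof -
        have "\<mu> = (\<mu> powr (1 / \<nu>)) powr \<nu>" using \<mu> \<open>\<nu> > 0\<close> by (simp add: powr_powr)
        also have "\<dots> \<le> real n powr \<nu>" using n(4) \<open>\<nu> > 0\<close> by (intro powr_mono2) auto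
        finally have "t \<le> real n powr \<nu> * real n powr (- 1 / \<aa>) * real n powr \<nu>"
          unfolding t_def using v \<mu> unfolding n_def[symmetric] by (intro mult_mono) auto
        also have "\<dots> = real n powr (\<nu> + (- 1 / \<aa>) + \<nu>)" by (simp only: powr_add)
        also have "\<nu> + (- 1 / \<aa>) + \<nu> = 0" using \<open>\<aa> > 0\<close> by (simp add: \<nu>_def field_simps)
        finally show ?thesis using n(3) by simp
      qed
      have rate: "\<kappa> * t powr \<aa> * real n = v powr \<aa>"
      proof -
        have "(real n powr (- 1 / \<aa>)) powr \<aa> = 1 / real n"
          using n(3) \<open>\<aa> > 0\<close> by (simp add: powr_powr powr_neg_one del: powr_minus)
        then have "t powr \<aa> = \<mu> powr \<aa> * (1 / real n) * v powr \<aa>"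
          unfolding t_def using \<mu> v by (simp add: powr_mult)
        then have "\<kappa> * t powr \<aa> * real n = (\<kappa> * \<mu> powr \<aa>) * v powr \<aa>"
          using n(3) by simp
        then show ?thesis using \<mu>(2) by simp
      qed
      obtain s where W: "window N h x = {s + 1..s + n}" and s: "\<bar>real N * x - real s\<bar> \<le> 2 * real n"
        using window_eq_interval[OF assms(1,2) N n_def n(3)] by blast
      define Bad where "Bad = {\<omega> \<in> space M. \<exists>i\<in>{1..n}. \<forall>k\<in>{1..n}. \<bar>real k - real i\<bar> \<le> \<tau> * real n \<longrightarrow>
         \<not> (y\<^sub>1 < \<epsilon> (int s + int k - 1) \<omega> \<and> \<epsilon> (int s + int k) \<omega> \<le> t * y\<^sub>1)}"
      have "Bad \<in> events" unfolding Bad_def by measurable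
      have qmle: "AE \<omega> in M. is_local_poly_qmle \<beta> N h x (ar_ratio f \<epsilon> N \<omega>) (fhat f \<omega>)"
        using est f by (simp add: is_qml_estimator_def)
      have "AE \<omega> in M. \<omega> \<in> ?E \<longrightarrow> \<omega> \<in> Bad"
        using regular qmle
      proof eventually_elim
        case (elim \<omega>)
        have "0 < \<epsilon> k \<omega>" "summable (\<lambda>i. \<rho> ^ i * \<epsilon> (k - int i) \<omega>)" for k
          using elim(1) by blast+
        note AR = tv_ar_recursion[where \<epsilon> = \<epsilon> and \<omega> = \<omega> and N = N, OF f this]
        define U where "U k = \<epsilon> (int k) \<omega> / tv_ar f \<epsilon> N (int k - 1) \<omega>" for k
        have X: "0 < tv_ar f \<epsilon> N k \<omega>" for k
          using AR(2)[of k] elim(1) by (meson less_le_trans)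
        have Y: "ar_ratio f \<epsilon> N \<omega> k = f (real k / real N) + U k" if "k \<in> window N h x" for k
        proof -
          have "real k / real N \<in> {0..1}" using that by (auto simp: window_def)
          then have "const_ext f (real_of_int (int k) / real N) = f (real k / real N)"
            by (simp add: const_ext_def divide_less_0_iff)
          then have "tv_ar f \<epsilon> N (int k) \<omega> = f (real k / real N) * tv_ar f \<epsilon> N (int k - 1) \<omega> + \<epsilon> (int k) \<omega>"
            using AR(1)[of "int k"] by simp
          then show ?thesis
            using X[of "int k - 1"] unfolding ar_ratio_def U_def by (simp add: field_simps)
        qed
        show ?case
        proof (intro impI, rule ccontr)
          assume E: "\<omega> \<in> ?E" and nb: "\<omega> \<notin> Bad"
          have close: "\<forall>i\<in>{1..n}. \<exists>k\<in>{1..n}. \<bar>real k - real i\<bar> \<le> \<tau> * real n \<and>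
              ar_ratio f \<epsilon> N \<omega> (s + k) \<le> f (real (s + k) / real N) + t"
          proof
            fix i assume "i \<in> {1..n}"
            then obtain k where k: "k \<in> {1..n}" "\<bar>real k - real i\<bar> \<le> \<tau> * real n"
              "y\<^sub>1 < \<epsilon> (int s + int k - 1) \<omega>" "\<epsilon> (int s + int k) \<omega> \<le> t * y\<^sub>1"
              using nb E unfolding Bad_def by blast
            have "U (s + k) \<le> t"
            proof -
              have "\<epsilon> (int (s + k)) \<omega> \<le> t * y\<^sub>1" using k(4) by simp
              also have "\<dots> \<le> t * tv_ar f \<epsilon> N (int (s + k) - 1) \<omega>"
                using k(3) AR(2)[of "int (s + k) - 1"] \<open>t > 0\<close> by (intro mult_left_mono) auto
              finally show ?thesis using X by (simp add: U_def pos_divide_le_eq)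
            qed
            then have "ar_ratio f \<epsilon> N \<omega> (s + k) \<le> f (real (s + k) / real N) + t"
              using Y[of "s + k"] k(1) W by simp
            with k show "\<exists>k\<in>{1..n}. \<bar>real k - real i\<bar> \<le> \<tau> * real n \<and>
              ar_ratio f \<epsilon> N \<omega> (s + k) \<le> f (real (s + k) / real N) + t" by blast
          qed
          have below: "\<forall>k\<in>window N h x. f (real k / real N) \<le> ar_ratio f \<epsilon> N \<omega> k"
            using Y elim(1) X by (auto simp: U_def less_imp_le)
          have "\<bar>fhat f \<omega> - f x\<bar> \<le> K * (t + L * h powr \<beta>)"
            using assms(1-3) f N n h elim(2)
            by (intro error[OF _ _ _ _ _ W s _ _ below close]) (auto simp: coeff_class_def)
          also have "\<dots> < c\<^sub>1 * h powr \<beta> + c\<^sub>2 * real n powr (- 1 / \<aa>) * v"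
            using h by (simp add: c\<^sub>1_def c\<^sub>2_def t_def algebra_simps)
          finally show False using E by (simp add: n_def)
        qed
      qed
      \<comment> \<open>The inclusion holds off the null set where positivity, summability or
        optimality fails, hence monotonicity in its almost sure form.\<close>
      then have "prob ?E \<le> prob Bad"
        using \<open>Bad \<in> events\<close> by (intro finite_measure_mono_AE)
      also have "\<dots> \<le> C * exp (- \<kappa> * t powr \<aa> * real n)"
        unfolding Bad_def using \<open>t > 0\<close> \<open>t \<le> 1\<close> n(2) by (rule gap)
      also have "- \<kappa> * t powr \<aa> * real n = - (v powr \<aa>)" using rate by simp
      also have "C * exp (- (v powr \<aa>)) \<le> c\<^sub>3 * exp (- (v powr \<aa>))"
        by (intro mult_right_mono) (simp_all add: c\<^sub>3_def add_nonneg_nonneg)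
      finally show ?thesis .
    qed
  qed
  \<comment> \<open>A real supremum is bounded by a common upper bound only over a nonempty index
    set; the zero function provides a member.\<close>
  have "coeff_class L \<beta> \<rho> \<noteq> {}" using zero_mem_coeff_class[of L \<rho> \<beta>] assms by auto
  then show ?thesis
    using \<open>c\<^sub>1 > 0\<close> \<open>c\<^sub>2 > 0\<close> \<open>c\<^sub>3 > 0\<close> \<open>\<nu> > 0\<close> bound
    by (intro exI[of _ c\<^sub>1] exI[of _ c\<^sub>2] exI[of _ c\<^sub>3] exI[of _ \<nu>]) (auto intro!: cSUP_least)
qed

end
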